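(* Let $\mathbb{F}=\mathbb{C}$ or $\mathbb{H}$, and let $X\in\mathfrak{sl}(n,\mathbb{F})$ be arbitrary. Then $X$ is $\mathrm{Ad}_{\mathrm{SL}(n,\mathbb{F})}$-real if and only if both of the following conditions hold: (1) For every $\lambda$ representing an eigenvalue class of $X$ such that (a) the real part of $\lambda$ is non-zero, in the case $\mathbb{F}=\mathbb{H}$, or (b) $\lambda\neq 0$, in the case $\mathbb{F}=\mathbb{C}$, the number $-\lambda$ also represents an eigenvalue class of $X$, with the same multiplicity. (2) For $\lambda$ as in (1), let $m$ be the common multiplicity of the eigenvalue classes represented by $\lambda$ and $-\lambda$, and let $\mathbf{d}_{\lambda}$ and $\mathbf{d}_{-\lambda}$ be the partitions of $m$ associated to the eigenvalue classes of $\lambda$ and $-\lambda$, respectively. Then $\mathbf{d}_\lambda=\mathbf{d}_{-\lambda}$.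
   Context: $\mathbb{H}=\mathbb{C}\oplus\mathbb{C}\mathbf{j}$ is the division ring of Hamilton's quaternions, with $\mathbb{C}=\mathbb{R}\oplus\mathbb{R}\mathbf{i}$. Write $A\in\mathrm{M}(n,\mathbb{H})$ as $A=A_1+A_2\mathbf{j}$ with $A_1,A_2\in\mathrm{M}(n,\mathbb{C})$, and put $\Phi(A)=\begin{pmatrix}A_1&A_2\\-\overline{A_2}&\overline{A_1}\end{pmatrix}\in\mathrm{M}(2n,\mathbb{C})$, $\det_{\mathbb{H}}(A)=\det\Phi(A)$, $\mathrm{tr}_{\mathbb{H}}(A)=\mathrm{tr}\,\Phi(A)$. $\mathrm{SL}(n,\mathbb{F})$ is the group of invertible $n\times n$ matrices over $\mathbb{F}$ with determinant $1$ (using $\det_{\mathbb{H}}$ if $\mathbb{F}=\mathbb{H}$); $\mathfrak{sl}(n,\mathbb{F})$ is the set of $n\times n$ matrices over $\mathbb{F}$ with trace $0$ (using $\mathrm{tr}_{\mathbb{H}}$ if $\mathbb{F}=\mathbb{H}$). For a linear Lie group $G$ with Lie algebra $\mathfrak{g}$, $X\in\mathfrak{g}$ is $\mathrm{Ad}_G$-real if $-X=gXg^{-1}$ for some $g\in G$. Eigenvalues over $\mathbb{H}$ are right eigenvalues ($Xv=v\lambda$, $v\ne0$); they occur in similarity classes $[\lambda]=\{\mu^{-1}\lambda\mu:\mu\in\mathbb{H}\setminus\{0\}\}$. Each class contains a unique complex number with non-negative imaginary part, called its unique complex representative; the complex numbers in the class are this number and its complex conjugate. Representatives $\lambda$ are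 taken in $\mathbb{C}$. Over $\mathbb{C}$ an eigenvalue class is just an eigenvalue. Jordan form: let $\mathrm{J}(m,\lambda)$ be the $m\times m$ matrix with $\lambda$ on the diagonal, $1$ on the superdiagonal and $0$ elsewhere. Every $X\in\mathrm{M}(n,\mathbb{F})$ is conjugate under $\mathrm{GL}(n,\mathbb{F})$ to a direct sum of Jordan blocks $\mathrm{J}(m,\lambda)$ with $\lambda\in\mathbb{C}$ (with non-negative imaginary part if $\mathbb{F}=\mathbb{H}$), unique up to permutation of blocks. The multiplicity of an eigenvalue (class) is the sum of the sizes of the Jordan blocks belonging to it (to its unique complex representative if $\mathbb{F}=\mathbb{H}$), and the partition associated to it is the partition of its multiplicity given by the sizes of these Jordan blocks. *)

theory Defs
  imports "Jordan_Normal_Form.Jordan_Normal_Form"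
begin

section \<open>Hamilton's quaternions\<close>

text \<open>\<open>Quat a b\<close> stands for \<open>a + b j\<close> with complex \<open>a\<close> and \<open>b\<close>; the product is determined
  by \<open>j z = cnj z j\<close> and \<open>j j = - 1\<close> (see \<open>quat_j_mult\<close> and \<open>quat_j_square\<close>).\<close>

datatype quat = Quat (cpart: complex) (jpart: complex)

lemma quat_eq_iff: "p = q \<longleftrightarrow> cpart p = cpart q \<and> jpart p = jpart q"
  by (cases p; cases q) simp

instantiation quat :: division_ring
begin

definition zero_quat :: quat where "0 = Quat 0 0"
definition one_quat :: quat where "1 = Quat 1 0"
definition plus_quat :: "quat \<Rightarrow> quat \<Rightarrow> quat" where
  "p + q = Quat (cpart p + cpart q) (jpart p + jpart q)"
definition uminus_quat :: "quat \<Rightarrow> quat" where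
  "- p = Quat (- cpart p) (- jpart p)"
definition minus_quat :: "quat \<Rightarrow> quat \<Rightarrow> quat" where
  "p - q = Quat (cpart p - cpart q) (jpart p - jpart q)"
definition times_quat :: "quat \<Rightarrow> quat \<Rightarrow> quat" where
  "p * q = Quat (cpart p * cpart q - jpart p * cnj (jpart q))
                (cpart p * jpart q + jpart p * cnj (cpart q))"
definition inverse_quat :: "quat \<Rightarrow> quat" where
  "inverse p = (let N = complex_of_real ((cmod (cpart p))\<^sup>2 + (cmod (jpart p))\<^sup>2)
                in Quat (cnj (cpart p) / N) (- jpart p / N))"
definition divide_quat :: "quat \<Rightarrow> quat \<Rightarrow> quat" where
  "divide p q = p * inverse (q :: quat)"

lemmas quat_ops = zero_quat_def one_quat_def plus_quat_def uminus_quat_def minus_quat_def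
  times_quat_def

lemma quat_norm_nonzero:
  assumes "(p :: quat) \<noteq> 0"
  shows "complex_of_real ((cmod (cpart p))\<^sup>2 + (cmod (jpart p))\<^sup>2) \<noteq> 0"
proof -
  have "cmod (cpart p) \<noteq> 0 \<or> cmod (jpart p) \<noteq> 0"
    using assms by (auto simp: quat_eq_iff zero_quat_def)
  then have "(cmod (cpart p))\<^sup>2 + (cmod (jpart p))\<^sup>2 \<noteq> 0"
    by (simp add: sum_power2_eq_zero_iff)
  then show ?thesis using of_real_eq_0_iff by blast
qed

instance
proof
  fix p q r :: quat
  show "p * q * r = p * (q * r)" by (simp add: quat_ops algebra_simps)
  show "1 * p = p" "p * 1 = p" by (simp_all add: quat_ops)
  show "p + q + r = p + (q + r)" "p + q = q + p" "0 + p = p" "- p + p = 0" "p - q = p + - q"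
    by (simp_all add: quat_ops algebra_simps)
  show "(p + q) * r = p * r + q * r" "p * (q + r) = p * q + p * r"
    by (simp_all add: quat_ops algebra_simps)
  show "(0 :: quat) \<noteq> 1" by (simp add: quat_ops)
  show "inverse (0 :: quat) = 0" by (simp add: quat_ops inverse_quat_def)
  show "divide p q = p * inverse q" by (rule divide_quat_def)
  assume "p \<noteq> 0"
  define N where "N = complex_of_real ((cmod (cpart p))\<^sup>2 + (cmod (jpart p))\<^sup>2)"
  have N0: "N \<noteq> 0" unfolding N_def by (rule quat_norm_nonzero) fact
  have N: "N = cpart p * cnj (cpart p) + jpart p * cnj (jpart p)"
    unfolding N_def by (simp only: of_real_add complex_norm_square)
  have cN: "cnj N = N" by (simp add: N mult.commute)
  have inv: "inverse p = Quat (cnj (cpart p) / N) (- jpart p / N)"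
    unfolding inverse_quat_def N_def Let_def ..
  show "inverse p * p = 1"
    using N0 by (simp add: inv quat_ops cN field_simps) (simp add: N algebra_simps)
  show "p * inverse p = 1"
    using N0 by (simp add: inv quat_ops cN field_simps) (simp add: N algebra_simps)
qed

end

definition quat_of_complex :: "complex \<Rightarrow> quat" where
  "quat_of_complex z = Quat z 0"

definition quat_j :: quat where
  "quat_j = Quat 0 1"

lemma quat_decomp: "q = quat_of_complex (cpart q) + quat_of_complex (jpart q) * quat_j"
  by (simp add: quat_eq_iff quat_of_complex_def quat_j_def quat_ops)

lemma quat_j_mult: "quat_j * quat_of_complex z = quat_of_complex (cnj z) * quat_j"
  by (simp add: quat_of_complex_def quat_j_def quat_ops)

lemma quat_j_square: "quat_j * quat_j = - 1"
  by (simp add: quat_j_def quat_ops)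

section \<open>Determinant and trace\<close>

definition mat_trace :: "'a :: comm_monoid_add mat \<Rightarrow> 'a" where
  "mat_trace A = (\<Sum>i<dim_row A. A $$ (i, i))"

definition quat_Phi :: "quat mat \<Rightarrow> complex mat" where
  "quat_Phi A = four_block_mat
     (map_mat cpart A)                  (map_mat jpart A)
     (- map_mat cnj (map_mat jpart A))  (map_mat cnj (map_mat cpart A))"

definition quat_det :: "quat mat \<Rightarrow> complex" where
  "quat_det A = det (quat_Phi A)"

definition quat_trace :: "quat mat \<Rightarrow> complex" where
  "quat_trace A = mat_trace (quat_Phi A)"

section \<open>The groups and Lie algebras; reality under the adjoint action\<close>

definition GL :: "nat \<Rightarrow> 'a :: ring_1 mat set" where
  "GL n = Units (ring_mat TYPE('a) n ())"

definition SL_complex :: "nat \<Rightarrow> complex mat set" where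
  "SL_complex n = {g \<in> GL n. det g = 1}"

definition SL_quat :: "nat \<Rightarrow> quat mat set" where
  "SL_quat n = {g \<in> GL n. quat_det g = 1}"

definition sl_complex :: "nat \<Rightarrow> complex mat set" where
  "sl_complex n = {X \<in> carrier_mat n n. mat_trace X = 0}"

definition sl_quat :: "nat \<Rightarrow> quat mat set" where
  "sl_quat n = {X \<in> carrier_mat n n. quat_trace X = 0}"

definition Ad_real :: "nat \<Rightarrow> 'a :: ring_1 mat set \<Rightarrow> 'a mat \<Rightarrow> bool" where
  "Ad_real n G X \<longleftrightarrow> (\<exists>g\<in>G. - X = g * X * inv\<^bsub>ring_mat TYPE('a) n ()\<^esub> g)"

section \<open>Right eigenvalues and their classes over the quaternions\<close>

definition right_eigenvalue :: "quat mat \<Rightarrow> quat \<Rightarrow> bool" where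
  "right_eigenvalue X q \<longleftrightarrow>
     (\<exists>v \<in> carrier_vec (dim_row X). v \<noteq> 0\<^sub>v (dim_row X) \<and> X *\<^sub>v v = map_vec (\<lambda>x. x * q) v)"

definition quat_class :: "quat \<Rightarrow> quat set" where
  "quat_class q = {inverse u * q * u | u. u \<noteq> 0}"

definition eigenvalue_classes :: "quat mat \<Rightarrow> quat set set" where
  "eigenvalue_classes X = {quat_class q | q. right_eigenvalue X q}"

definition complex_rep :: "quat set \<Rightarrow> complex" where
  "complex_rep c = (THE z. quat_of_complex z \<in> c \<and> 0 \<le> Im z)"

lemma quat_class_complex_iff:
  "quat_of_complex w \<in> quat_class (quat_of_complex z) \<longleftrightarrow> w = z \<or> w = cnj z"
proof
  assume "quat_of_complex w \<in> quat_class (quat_of_complex z)"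
  then obtain u where u: "u \<noteq> 0" and eq: "quat_of_complex w = inverse u * quat_of_complex z * u"
    by (auto simp: quat_class_def)
  have "u * quat_of_complex w = quat_of_complex z * u"
    using u by (simp add: eq mult.assoc [symmetric])
  then have "cpart u * w = z * cpart u" "jpart u * cnj w = z * jpart u"
    by (simp_all add: quat_of_complex_def quat_ops)
  moreover have "cpart u \<noteq> 0 \<or> jpart u \<noteq> 0"
    using u by (auto simp: quat_eq_iff zero_quat_def)
  ultimately have "w = z \<or> cnj w = z" by auto
  then show "w = z \<or> w = cnj z" by auto
next
  have "inverse quat_j = - quat_j"
    by (rule inverse_unique) (simp add: quat_j_square)
  then have "inverse quat_j * quat_of_complex z * quat_j = quat_of_complex (cnj z)"
    by (simp add: quat_of_complex_def quat_j_def quat_ops)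
  moreover have "quat_j \<noteq> 0" by (simp add: quat_j_def quat_ops)
  ultimately have "quat_of_complex (cnj z) \<in> quat_class (quat_of_complex z)"
    unfolding quat_class_def by (intro CollectI exI [of _ quat_j]) simp
  moreover have "quat_of_complex z \<in> quat_class (quat_of_complex z)"
    unfolding quat_class_def by (intro CollectI exI [of _ 1]) simp
  moreover assume "w = z \<or> w = cnj z"
  ultimately show "quat_of_complex w \<in> quat_class (quat_of_complex z)" by auto
qed

lemma complex_rep_eq:
  "complex_rep (quat_class (quat_of_complex z)) = (if 0 \<le> Im z then z else cnj z)"
  unfolding complex_rep_def quat_class_complex_iff
  by (rule the_equality) (auto simp: complex_eq_iff)

section \<open>Jordan forms, associated partitions and multiplicities\<close>

text \<open>As in \<open>jordan_nf\<close>, the list consists of pairs (size of the block, diagonal entry).\<close>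

definition quat_jordan_nf :: "quat mat \<Rightarrow> (nat \<times> complex) list \<Rightarrow> bool" where
  "quat_jordan_nf X n_as \<longleftrightarrow>
     (\<forall>(m, z) \<in> set n_as. 0 \<le> Im z) \<and>
     jordan_nf X (map (\<lambda>(m, z). (m, quat_of_complex z)) n_as)"

definition block_sizes :: "(nat \<times> 'a) list \<Rightarrow> 'a \<Rightarrow> nat multiset" where
  "block_sizes n_as z = image_mset fst (filter_mset (\<lambda>b. snd b = z) (mset n_as))"

text \<open>Jordan forms are unique up to the order of the blocks, hence the definite descriptions;
  a partition is the multiset of its parts.\<close>

definition partition_complex :: "complex mat \<Rightarrow> complex \<Rightarrow> nat multiset" where
  "partition_complex X z = (THE d. \<exists>n_as. jordan_nf X n_as \<and> d = block_sizes n_as z)"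

definition partition_quat :: "quat mat \<Rightarrow> quat set \<Rightarrow> nat multiset" where
  "partition_quat X c =
     (THE d. \<exists>n_as. quat_jordan_nf X n_as \<and> d = block_sizes n_as (complex_rep c))"

definition multiplicity_complex :: "complex mat \<Rightarrow> complex \<Rightarrow> nat" where
  "multiplicity_complex X z = sum_mset (partition_complex X z)"

definition multiplicity_quat :: "quat mat \<Rightarrow> quat set \<Rightarrow> nat" where
  "multiplicity_quat X c = sum_mset (partition_quat X c)"

text \<open>The eigenvalue class represented by a complex number; \<open>z\<close> represents an eigenvalue class
  of \<open>X\<close> iff \<open>rep_class z \<in> eigenvalue_classes X\<close>. Both complex members of a class represent
  it, not only the one with non-negative imaginary part.\<close>

abbreviation rep_class :: "complex \<Rightarrow> quat set" where
  "rep_class z \<equiv> quat_class (quat_of_complex z)"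

end

theory Submission
  imports Defs
    "Jordan_Normal_Form.Jordan_Normal_Form_Existence"
    "Jordan_Normal_Form.Jordan_Normal_Form_Uniqueness"
begin

text \<open>Over either ground ring the theorem splits into two independent facts.

  First, scaling an intertwiner \<open>g\<close> with \<open>- X * g = g * X\<close> by a central scalar leaves it an
  intertwiner, and a suitable scalar makes its determinant \<open>1\<close>. Over the complex numbers an
  \<open>n\<close>-th root is available. Over the quaternions only real scalars are central, and real
  scaling suffices because \<open>quat_det\<close> takes non-negative real values
  (\<open>quat_det_real_nonneg\<close>). Hence \<open>X\<close> is real under the special linear group iff \<open>- X\<close> is
  similar to \<open>X\<close> (\<open>Ad_real_SL_complex_iff\<close>, \<open>Ad_real_SL_quat_iff\<close>).

  Second, similarity is decided by Jordan forms. Negation turns a block \<open>(m, z)\<close> into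
  \<open>(m, - z)\<close>, so a complex \<open>X\<close> is similar to \<open>- X\<close> iff its block sizes at \<open>z\<close> and at \<open>- z\<close>
  agree for every \<open>z\<close> (\<open>similar_uminus_iff_block_sizes\<close>). This is condition (2), and it
  contains condition (1): multiplicities are the sums of the parts, and the eigenvalues are the
  numbers with a non-empty partition.

  The quaternionic case is reduced to the complex one through \<open>quat_Phi\<close>. Every complex matrix
  of even size is uniquely \<open>quat_Phi A + \<i> quat_Phi B\<close>, and a complex intertwiner of \<open>quat_Phi X\<close>
  and \<open>quat_Phi Y\<close> gives the quaternionic intertwiners \<open>A + t B\<close> for real \<open>t\<close>, almost all of
  them invertible. So \<open>X\<close> and \<open>Y\<close> are similar iff \<open>quat_Phi X\<close> and \<open>quat_Phi Y\<close> are
  (\<open>quat_similar_iff_Phi_similar\<close>). Since \<open>quat_Phi\<close> maps a Jordan matrix with blocks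
  \<open>(m, z)\<close> to one with blocks \<open>(m, z)\<close> and \<open>(m, cnj z)\<close>, quaternionic Jordan forms of \<open>X\<close> amount
  to ways of halving the complex Jordan form of \<open>quat_Phi X\<close> (\<open>quat_jordan_nf_iff\<close>). There is
  exactly one: the blocks of \<open>quat_Phi X\<close> are symmetric under conjugation, and those with real
  eigenvalue come in pairs, because kernels of matrices \<open>quat_Phi A\<close> carry an antilinear map of
  square \<open>- 1\<close> and have even dimension (\<open>kernel_dim_quat_Phi_even\<close>).

  For purely imaginary \<open>z\<close>, finally, \<open>- z\<close> is the conjugate of \<open>z\<close> and represents the same
  quaternionic class; that is why the conditions over the quaternions concern only \<open>z\<close> with
  non-zero real part.\<close>

section \<open>Jordan forms over a field as multisets of blocks\<close>

text \<open>The number of blocks of each size \<open>k\<close> is a second difference in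
  \<open>k\<close> of the dimensions of the kernels of the powers
  \<open>(A - z)^k\<close>, hence depends on \<open>A\<close> only. That formula says
  nothing about size \<open>0\<close>, which \<open>jordan_nf\<close> excludes.\<close>

lemma jordan_nf_mset_unique:
  fixes A :: "'a :: field mat"
  assumes "jordan_nf A xs" "jordan_nf A ys"
  shows "mset xs = mset ys"
proof (rule multiset_eqI)
  fix b :: "nat \<times> 'a"
  obtain k z where b: "b = (k, z)" by force
  show "count (mset xs) b = count (mset ys) b"
  proof (cases "k = 0")
    case True
    then have "b \<notin> set xs" "b \<notin> set ys"
      using assms unfolding jordan_nf_def b by force+
    then show ?thesis by (metis count_mset_0_iff)
  next
    case False
    have "count (mset l) b = compute_nr_of_jordan_blocks A z k" if "jordan_nf A l" for l
      using compute_nr_of_jordan_blocks[OF that False, of z]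
      by (simp add: b count_mset count_list_eq_length_filter)
    then show ?thesis using assms by metis
  qed
qed

lemma jordan_matrix_append:
  "jordan_matrix (xs @ ys) = four_block_mat
     (jordan_matrix xs) (0\<^sub>m (sum_list (map fst xs)) (sum_list (map fst ys)))
     (0\<^sub>m (sum_list (map fst ys)) (sum_list (map fst xs))) (jordan_matrix ys)"
proof -
  have "jordan_matrix (xs @ ys) = jordan_matrix (concat [xs, ys])" by simp
  also have "\<dots> = diag_block_mat [jordan_matrix xs, jordan_matrix ys]"
    by (subst jordan_matrix_concat_diag_block_mat) simp
  also have "\<dots> = four_block_mat
     (jordan_matrix xs) (0\<^sub>m (sum_list (map fst xs)) (sum_list (map fst ys)))
     (0\<^sub>m (sum_list (map fst ys)) (sum_list (map fst xs))) (jordan_matrix ys)"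
    by (intro eq_matI) (auto simp: Let_def)
  finally show ?thesis .
qed

lemma similar_mat_swap_diagonal_blocks:
  fixes A B :: "'a :: semiring_1 mat"
  assumes A: "A \<in> carrier_mat a a" and B: "B \<in> carrier_mat b b"
  shows "similar_mat (four_block_mat A (0\<^sub>m a b) (0\<^sub>m b a) B)
                     (four_block_mat B (0\<^sub>m b a) (0\<^sub>m a b) A)"
proof -
  let ?P = "four_block_mat (0\<^sub>m a b) (1\<^sub>m a) (1\<^sub>m b) (0\<^sub>m b a) :: 'a mat"
  let ?Q = "four_block_mat (0\<^sub>m b a) (1\<^sub>m b) (1\<^sub>m a) (0\<^sub>m a b) :: 'a mat"
  have 1: "?P * four_block_mat B (0\<^sub>m b a) (0\<^sub>m a b) A
      = four_block_mat (0\<^sub>m a b) A B (0\<^sub>m b a)"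
    using A B by (subst mult_four_block_mat[of _ a b _ a _ b]) auto
  have 2: "four_block_mat (0\<^sub>m a b) A B (0\<^sub>m b a) * ?Q
      = four_block_mat A (0\<^sub>m a b) (0\<^sub>m b a) B"
    using A B by (subst mult_four_block_mat[of _ a b _ a _ b]) auto
  have 3: "?P * ?Q = 1\<^sub>m (a + b)"
    by (subst mult_four_block_mat[of _ a b _ a _ b]) auto
  have 4: "?Q * ?P = 1\<^sub>m (a + b)"
    by (subst mult_four_block_mat[of _ b a _ b _ a]) (auto simp: add.commute)
  show ?thesis
    by (rule similar_matI[of _ _ ?P ?Q "a + b"]) (use A B 1 2 3 4 in \<open>auto simp: add.commute\<close>)
qed

lemma jordan_matrix_Cons_similar:
  fixes xs ys :: "(nat \<times> 'a :: ring_1) list"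
  assumes sim: "similar_mat (jordan_matrix xs) (jordan_matrix ys)"
  shows "similar_mat (jordan_matrix (x # xs)) (jordan_matrix (x # ys))"
proof -
  have dim: "sum_list (map fst xs) = sum_list (map fst ys)"
  proof -
    obtain n where "{jordan_matrix xs, jordan_matrix ys} \<subseteq> carrier_mat n n"
      using similar_matD[OF sim] by blast
    then show ?thesis unfolding carrier_mat_def by simp
  qed
  have Cons: "jordan_matrix (x # zs) = four_block_mat
     (jordan_matrix [x]) (0\<^sub>m (fst x) (sum_list (map fst zs)))
     (0\<^sub>m (sum_list (map fst zs)) (fst x)) (jordan_matrix zs)" for zs
    using jordan_matrix_append[of "[x]" zs] by (simp only: append_Cons append_Nil list.map sum_list.Cons sum_list.Nil add_0_right)
  have "similar_mat (jordan_matrix [x]) (jordan_matrix [x])"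
    by (rule similar_mat_refl[OF jordan_matrix_carrier])
  from similar_mat_four_block_0_0[OF this sim, of "fst x" "sum_list (map fst ys)"] show ?thesis
    unfolding Cons[of xs] Cons[of ys] dim using dim jordan_matrix_carrier[of "[x]"] jordan_matrix_carrier[of xs]
    by simp
qed

text \<open>Moving the block \<open>x\<close> to the front is a cyclic rotation of the
  list, that is, a swap of two diagonal blocks; the induction hypothesis then rearranges
  the rest.\<close>

lemma jordan_matrix_similar_perm:
  fixes xs ys :: "(nat \<times> 'a :: ring_1) list"
  assumes "mset xs = mset ys"
  shows "similar_mat (jordan_matrix xs) (jordan_matrix ys)"
  using assms
proof (induction xs arbitrary: ys)
  case Nil
  then show ?case using similar_mat_refl[OF jordan_matrix_carrier] by auto
next
  case (Cons x xs)
  then have "x \<in> set ys" by (metis list.set_intros(1) mset_eq_setD)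
  then obtain us vs where ys: "ys = us @ x # vs" by (meson split_list)
  with Cons.prems have "mset xs = mset (vs @ us)" by simp
  from jordan_matrix_Cons_similar[OF Cons.IH[OF this], of x]
  have "similar_mat (jordan_matrix (x # xs)) (jordan_matrix ((x # vs) @ us))" by simp
  also have "similar_mat (jordan_matrix ((x # vs) @ us)) (jordan_matrix ys)"
    unfolding ys jordan_matrix_append
    by (rule similar_mat_swap_diagonal_blocks) auto
  finally (similar_mat_trans) show ?case .
qed

lemma similar_iff_jordan_mset:
  fixes A B :: "'a :: field mat"
  assumes A: "jordan_nf A xs" and B: "jordan_nf B ys"
  shows "similar_mat A B \<longleftrightarrow> mset xs = mset ys"
proof
  assume "similar_mat A B"
  then have "jordan_nf A ys"
    using B similar_mat_trans unfolding jordan_nf_def by blast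
  then show "mset xs = mset ys" by (rule jordan_nf_mset_unique[OF A])
next
  assume "mset xs = mset ys"
  then show "similar_mat A B"
    using A B jordan_matrix_similar_perm[of xs ys] similar_mat_trans similar_mat_sym
    unfolding jordan_nf_def by meson
qed

lemma multiset_add_self_eq_iff: "A + A = B + B \<longleftrightarrow> A = B" for A B :: "'a multiset"
proof
  assume eq: "A + A = B + B"
  show "A = B"
  proof (rule multiset_eqI)
    fix x
    have "count A x + count A x = count B x + count B x"
      using arg_cong[OF eq, of "\<lambda>M. count M x"] by (simp only: count_union)
    then show "count A x = count B x" by linarith
  qed
qed simp

lemma count_block_sizes: "count (block_sizes xs z) k = count (mset xs) (k, z)"
proof (induction xs)
  case (Cons b xs)
  then show ?case by (cases b) (simp add: block_sizes_def)
qed (simp add: block_sizes_def)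

lemma block_sizes_eq_iff_mset_eq: "(\<forall>z. block_sizes xs z = block_sizes ys z) \<longleftrightarrow> mset xs = mset ys"
  by (simp add: multiset_eq_iff count_block_sizes) (metis surj_pair)

lemma block_sizes_append: "block_sizes (xs @ ys) z = block_sizes xs z + block_sizes ys z"
  by (rule multiset_eqI) (simp add: count_block_sizes)

lemma block_sizes_map_inj:
  assumes "inj f"
  shows "block_sizes (map (map_prod id f) xs) (f z) = block_sizes xs z"
  by (induction xs) (auto simp: block_sizes_def inj_eq[OF assms])

lemma block_sizes_empty_iff: "block_sizes xs z = {#} \<longleftrightarrow> z \<notin> snd ` set xs"
  by (induction xs) (auto simp: block_sizes_def)

lemma eigenvalue_iff_block_sizes:
  fixes A :: "'a :: field mat"
  assumes "jordan_nf A xs" "A \<in> carrier_mat n n"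
  shows "eigenvalue A z \<longleftrightarrow> block_sizes xs z \<noteq> {#}"
proof -
  have pos: "0 \<notin> fst ` set xs" using assms unfolding jordan_nf_def by auto
  have "eigenvalue A z \<longleftrightarrow> poly (\<Prod>(n, a)\<leftarrow>xs. [:- a, 1:] ^ n) z = 0"
    unfolding eigenvalue_root_char_poly[OF assms(2)] jordan_nf_char_poly[OF assms(1)] ..
  also have "\<dots> \<longleftrightarrow> z \<in> snd ` set xs"
    using pos by (induction xs) auto
  finally show ?thesis by (simp add: block_sizes_empty_iff)
qed

lemma jordan_nf_uminus:
  fixes A :: "'a :: field mat"
  assumes "jordan_nf A xs"
  shows "jordan_nf (- A) (map (map_prod id uminus) xs)"
proof -
  have "(- 1) \<cdot>\<^sub>m A = - A" by (intro eq_matI) auto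
  moreover have "(\<lambda>(n :: nat, a :: 'a). (n, - a)) = map_prod id (uminus :: 'a \<Rightarrow> 'a)" by auto
  ultimately show ?thesis using jordan_nf_smult[OF assms, of "- 1"] by simp
qed

text \<open>Over the complex numbers this already decides reality under the general
  linear group.\<close>

lemma similar_uminus_iff_block_sizes:
  fixes A :: "'a :: field mat"
  assumes "jordan_nf A xs"
  shows "similar_mat (- A) A \<longleftrightarrow> (\<forall>z. block_sizes xs z = block_sizes xs (- z))"
proof -
  have "block_sizes (map (map_prod id uminus) xs) z = block_sizes xs (- z)" for z :: 'a
    using block_sizes_map_inj[OF inj_uminus, of xs "- z"] by simp
  then show ?thesis
    unfolding similar_iff_jordan_mset[OF jordan_nf_uminus[OF assms] assms]
      block_sizes_eq_iff_mset_eq[symmetric] by metis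
qed

lemma complex_jordan_nf_exists:
  assumes "(A :: complex mat) \<in> carrier_mat n n"
  obtains xs where "jordan_nf A xs"
  using char_poly_factorized[OF assms] jordan_nf_exists[OF assms] by metis

lemma partition_complex_eq:
  assumes "jordan_nf X xs"
  shows "partition_complex X z = block_sizes xs z"
  unfolding partition_complex_def
proof (rule the_equality)
  fix d assume "\<exists>n_as. jordan_nf X n_as \<and> d = block_sizes n_as z"
  then show "d = block_sizes xs z"
    using jordan_nf_mset_unique[OF assms] block_sizes_eq_iff_mset_eq by metis
qed (use assms in blast)

section \<open>The complex representation of quaternionic matrices\<close>

lemma quat_Phi_carrier [simp]:
  "A \<in> carrier_mat n m \<Longrightarrow> quat_Phi A \<in> carrier_mat (n + n) (m + m)"
  by (auto simp: quat_Phi_def intro!: four_block_carrier_mat)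

lemma quat_Phi_dim [simp]:
  "dim_row (quat_Phi A) = dim_row A + dim_row A" "dim_col (quat_Phi A) = dim_col A + dim_col A"
  by (simp_all add: quat_Phi_def)

lemma quat_Phi_index:
  assumes "i < dim_row A" "j < dim_col A"
  shows "quat_Phi A $$ (i, j) = cpart (A $$ (i, j))"
    and "quat_Phi A $$ (i, dim_col A + j) = jpart (A $$ (i, j))"
    and "quat_Phi A $$ (dim_row A + i, j) = - cnj (jpart (A $$ (i, j)))"
    and "quat_Phi A $$ (dim_row A + i, dim_col A + j) = cnj (cpart (A $$ (i, j)))"
  using assms by (simp_all add: quat_Phi_def)

lemma cpart_simps [simp]:
  "cpart 0 = 0" "cpart 1 = 1" "cpart (p + q) = cpart p + cpart q" "cpart (- p) = - cpart p"
  "cpart (p * q) = cpart p * cpart q - jpart p * cnj (jpart q)"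
  by (simp_all add: quat_ops)

lemma jpart_simps [simp]:
  "jpart 0 = 0" "jpart 1 = 0" "jpart (p + q) = jpart p + jpart q" "jpart (- p) = - jpart p"
  "jpart (p * q) = cpart p * jpart q + jpart p * cnj (cpart q)"
  by (simp_all add: quat_ops)

lemma cpart_sum: "cpart (sum f S) = (\<Sum>i\<in>S. cpart (f i))"
  by (induction S rule: infinite_finite_induct) auto

lemma jpart_sum: "jpart (sum f S) = (\<Sum>i\<in>S. jpart (f i))"
  by (induction S rule: infinite_finite_induct) auto

lemma quat_Phi_mult:
  assumes A: "A \<in> carrier_mat n m" and B: "B \<in> carrier_mat m k"
  shows "quat_Phi (A * B) = quat_Phi A * quat_Phi B"
  unfolding quat_Phi_def
  by (subst mult_four_block_mat[of _ n m _ m _ n _ _ k _ k])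
    (use A B in \<open>auto simp: scalar_prod_def cpart_sum jpart_sum sum.distrib sum_subtractf
      sum_negf intro!: cong_four_block_mat eq_matI\<close>)

lemma quat_Phi_one [simp]: "quat_Phi (1\<^sub>m n) = 1\<^sub>m (n + n)"
  by (subst four_block_one_mat[symmetric], unfold quat_Phi_def, rule cong_four_block_mat)
    (auto intro!: eq_matI)

lemma quat_Phi_zero [simp]: "quat_Phi (0\<^sub>m n m) = 0\<^sub>m (n + n) (m + m)"
  by (rule eq_matI) (auto simp: quat_Phi_def)

lemma quat_Phi_uminus [simp]: "quat_Phi (- A) = - quat_Phi A"
  by (rule eq_matI) (auto simp: quat_Phi_def)

lemma quat_Phi_add:
  "A \<in> carrier_mat n m \<Longrightarrow> B \<in> carrier_mat n m \<Longrightarrow> quat_Phi (A + B) = quat_Phi A + quat_Phi B"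
  by (rule eq_matI) (auto simp: quat_Phi_def)

lemma quat_Phi_smult_real:
  "quat_Phi (quat_of_complex (of_real t) \<cdot>\<^sub>m A) = of_real t \<cdot>\<^sub>m quat_Phi A"
  by (rule eq_matI) (auto simp: quat_Phi_def quat_of_complex_def)

text \<open>The complex matrices of size \<open>2 n\<close> are the complexification of
  the image of \<open>quat_Phi\<close>. That image is the fixed set of the
  conjugate-linear involution
  \<open>(P, Q; R, S) \<mapsto> (cnj S, - cnj R; - cnj Q, cnj P)\<close>, and
  \<open>A\<close> and \<open>B\<close> come from the two eigenspaces of this
  involution.\<close>

lemma quat_Phi_complexification:
  assumes P: "P \<in> carrier_mat (n + n) (n + n)"
  obtains A B where "A \<in> carrier_mat n n" "B \<in> carrier_mat n n"
    "P = quat_Phi A + \<i> \<cdot>\<^sub>m quat_Phi B"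
proof
  let ?A = "mat n n (\<lambda>(i, j). Quat ((P $$ (i, j) + cnj (P $$ (n + i, n + j))) / 2)
                                ((P $$ (i, n + j) - cnj (P $$ (n + i, j))) / 2))"
  let ?B = "mat n n (\<lambda>(i, j). Quat ((P $$ (i, j) - cnj (P $$ (n + i, n + j))) / (2 * \<i>))
                                ((P $$ (i, n + j) + cnj (P $$ (n + i, j))) / (2 * \<i>)))"
  show A: "?A \<in> carrier_mat n n" and B: "?B \<in> carrier_mat n n" by auto
  show "P = quat_Phi ?A + \<i> \<cdot>\<^sub>m quat_Phi ?B"
  proof (rule eq_matI)
    fix i j assume "i < dim_row (quat_Phi ?A + \<i> \<cdot>\<^sub>m quat_Phi ?B)" "j < dim_col (quat_Phi ?A + \<i> \<cdot>\<^sub>m quat_Phi ?B)"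
    then have ij: "i < n + n" "j < n + n" by auto
    have [simp]: "i - n < n" "j - n < n" "\<not> i < n \<Longrightarrow> n + (i - n) = i" "\<not> j < n \<Longrightarrow> n + (j - n) = j"
      using ij by auto
    show "P $$ (i, j) = (quat_Phi ?A + \<i> \<cdot>\<^sub>m quat_Phi ?B) $$ (i, j)"
      using ij by (simp add: quat_Phi_def) (auto simp: field_simps)
  qed (use P in auto)
qed

lemma quat_Phi_complexification_unique:
  assumes "A \<in> carrier_mat n m" "B \<in> carrier_mat n m" "C \<in> carrier_mat n m" "D \<in> carrier_mat n m"
    and eq: "quat_Phi A + \<i> \<cdot>\<^sub>m quat_Phi B = quat_Phi C + \<i> \<cdot>\<^sub>m quat_Phi D"
  shows "A = C" "B = D"
proof -
  have cancel: "a = c \<and> b = d" if "a + \<i> * b = c + \<i> * d" "cnj a + \<i> * cnj b = cnj c + \<i> * cnj d" for a b c d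
    using that by (simp add: complex_eq_iff)
  have ent: "A $$ (i, j) = C $$ (i, j) \<and> B $$ (i, j) = D $$ (i, j)" if ij: "i < n" "j < m" for i j
  proof -
    have e: "quat_Phi A $$ (k, l) + \<i> * quat_Phi B $$ (k, l) = quat_Phi C $$ (k, l) + \<i> * quat_Phi D $$ (k, l)"
      if "k < n + n" "l < m + m" for k l
      using arg_cong[OF eq, of "\<lambda>M. M $$ (k, l)"] that assms(1-4) by auto
    have c: "cpart (A $$ (i, j)) + \<i> * cpart (B $$ (i, j)) = cpart (C $$ (i, j)) + \<i> * cpart (D $$ (i, j))"
      "cnj (cpart (A $$ (i, j))) + \<i> * cnj (cpart (B $$ (i, j)))
        = cnj (cpart (C $$ (i, j))) + \<i> * cnj (cpart (D $$ (i, j)))"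
      using e[of i j] e[of "n + i" "m + j"] ij assms by (auto simp: quat_Phi_def)
    have j: "jpart (A $$ (i, j)) + \<i> * jpart (B $$ (i, j)) = jpart (C $$ (i, j)) + \<i> * jpart (D $$ (i, j))"
      using e[of i "m + j"] ij assms by (auto simp: quat_Phi_def)
    have j': "- (cnj (jpart (A $$ (i, j))) + \<i> * cnj (jpart (B $$ (i, j))))
        = - (cnj (jpart (C $$ (i, j))) + \<i> * cnj (jpart (D $$ (i, j))))"
      using e[of "n + i" j] ij assms by (auto simp: quat_Phi_def)
    then have j': "cnj (jpart (A $$ (i, j))) + \<i> * cnj (jpart (B $$ (i, j)))
        = cnj (jpart (C $$ (i, j))) + \<i> * cnj (jpart (D $$ (i, j)))"
      by (simp only: neg_equal_iff_equal)
    from cancel[OF c] cancel[OF j j'] show ?thesis by (simp add: quat_eq_iff)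
  qed
  show "A = C" "B = D" using ent assms(1-4) by (auto intro!: eq_matI)
qed

text \<open>The two quaternionic parts of the complex inverse of
  \<open>quat_Phi A\<close> solve the equations for an inverse separately, so the first
  part already is the inverse.\<close>

lemma quat_mat_invertible:
  assumes A: "A \<in> carrier_mat n n" and det: "det (quat_Phi A) \<noteq> 0"
  obtains B where "B \<in> carrier_mat n n" "A * B = 1\<^sub>m n" "B * A = 1\<^sub>m n"
proof -
  have PA: "quat_Phi A \<in> carrier_mat (n + n) (n + n)" using A by simp
  from det_non_zero_imp_unit[OF PA det] obtain Q where
    Q: "Q \<in> carrier_mat (n + n) (n + n)" "quat_Phi A * Q = 1\<^sub>m (n + n)" "Q * quat_Phi A = 1\<^sub>m (n + n)"
    by (auto simp: Units_def ring_mat_def)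
  obtain B C where BC: "B \<in> carrier_mat n n" "C \<in> carrier_mat n n" and
    Q_eq: "Q = quat_Phi B + \<i> \<cdot>\<^sub>m quat_Phi C"
    using quat_Phi_complexification[OF Q(1)] .
  have PB: "quat_Phi B \<in> carrier_mat (n + n) (n + n)" "quat_Phi C \<in> carrier_mat (n + n) (n + n)"
    using BC by auto
  have "quat_Phi (A * B) + \<i> \<cdot>\<^sub>m quat_Phi (A * C) = quat_Phi (1\<^sub>m n) + \<i> \<cdot>\<^sub>m quat_Phi (0\<^sub>m n n)"
    using Q(2) PA PB unfolding Q_eq quat_Phi_mult[OF A BC(1)] quat_Phi_mult[OF A BC(2)]
    by (simp add: mult_add_distrib_mat[of _ "n + n" "n + n" _ "n + n"] mult_smult_distrib[of _ "n + n" "n + n" _ "n + n"])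
  then have 1: "A * B = 1\<^sub>m n"
    by (rule quat_Phi_complexification_unique(1)[rotated -1]) (use A BC in auto)
  have "quat_Phi (B * A) + \<i> \<cdot>\<^sub>m quat_Phi (C * A) = quat_Phi (1\<^sub>m n) + \<i> \<cdot>\<^sub>m quat_Phi (0\<^sub>m n n)"
    using Q(3) PA PB unfolding Q_eq quat_Phi_mult[OF BC(1) A] quat_Phi_mult[OF BC(2) A]
    by (simp add: add_mult_distrib_mat[of _ "n + n" "n + n" _ _ "n + n"] mult_smult_assoc_mat[of _ "n + n" "n + n" _ "n + n"])
  then have 2: "B * A = 1\<^sub>m n"
    by (rule quat_Phi_complexification_unique(1)[rotated -1]) (use A BC in auto)
  from BC(1) 1 2 show ?thesis by (rule that)
qed

text \<open>The determinant is a polynomial in the parameter that does not vanish at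
  \<open>z\<close>, so it has only finitely many roots, and the real line is infinite.\<close>

lemma exists_real_det_nonzero:
  assumes M: "M \<in> carrier_mat n n" and N: "N \<in> carrier_mat n n"
    and det: "det (M + z \<cdot>\<^sub>m N) \<noteq> (0 :: complex)"
  obtains t :: real where "det (M + of_real t \<cdot>\<^sub>m N) \<noteq> 0"
proof -
  define p where "p = det (map_mat (\<lambda>a. [:a:]) M + map_mat (\<lambda>a. [:0, a:]) N)"
  have p: "poly p w = det (M + w \<cdot>\<^sub>m N)" for w
  proof -
    have "poly p w = det (map_mat (\<lambda>q. poly q w) (map_mat (\<lambda>a. [:a:]) M + map_mat (\<lambda>a. [:0, a:]) N))"
      unfolding p_def by (rule comm_ring_hom.hom_det[OF poly_hom.comm_ring_hom_axioms, symmetric])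
    also have "map_mat (\<lambda>q. poly q w) (map_mat (\<lambda>a. [:a:]) M + map_mat (\<lambda>a. [:0, a:]) N) = M + w \<cdot>\<^sub>m N"
      by (rule eq_matI) (use M N in auto)
    finally show ?thesis .
  qed
  have "p \<noteq> 0" using det p[of z] by auto
  then have "finite {w. poly p w = 0}" by (rule poly_roots_finite)
  moreover have "infinite (range complex_of_real)"
    using finite_imageD[of complex_of_real UNIV] infinite_UNIV_char_0[where 'a = real] inj_of_real[where 'a = complex] by auto
  ultimately obtain w where "w \<in> range complex_of_real" "poly p w \<noteq> 0"
    by (metis (mono_tags, lifting) finite_subset mem_Collect_eq subsetI)
  then show ?thesis using that p by auto
qed

lemma quat_mult_smult_real:
  assumes A: "A \<in> carrier_mat n m" and B: "B \<in> carrier_mat m k"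
  shows "A * (quat_of_complex (of_real t) \<cdot>\<^sub>m B) = quat_of_complex (of_real t) \<cdot>\<^sub>m (A * B)"
    and "(quat_of_complex (of_real t) \<cdot>\<^sub>m A) * B = quat_of_complex (of_real t) \<cdot>\<^sub>m (A * B)"
proof -
  let ?t = "quat_of_complex (of_real t)"
  have "?t * q = q * ?t" for q by (simp add: quat_eq_iff quat_of_complex_def)
  then have t: "p * (?t * q) = ?t * (p * q)" for p q by (metis mult.assoc)
  show "A * (?t \<cdot>\<^sub>m B) = ?t \<cdot>\<^sub>m (A * B)"
    using A B by (intro eq_matI) (auto simp: scalar_prod_def sum_distrib_left t)
  show "(?t \<cdot>\<^sub>m A) * B = ?t \<cdot>\<^sub>m (A * B)"
    using A B by (intro eq_matI) (auto simp: scalar_prod_def sum_distrib_left mult.assoc)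
qed

text \<open>For the non-trivial direction, both parts of a complex intertwiner
  \<open>quat_Phi A + \<i> quat_Phi B\<close> intertwine \<open>X\<close> and
  \<open>Y\<close> over the quaternions. Neither need be invertible, but
  \<open>A + t B\<close> is for some real \<open>t\<close>; real scalars are central, so
  this still intertwines.\<close>

lemma quat_similar_iff_Phi_similar:
  assumes X: "X \<in> carrier_mat n n" and Y: "Y \<in> carrier_mat n n"
  shows "similar_mat (quat_Phi X) (quat_Phi Y) \<longleftrightarrow> similar_mat X Y"
proof
  assume "similar_mat X Y"
  then obtain P Q where "similar_mat_wit X Y P Q" by (auto simp: similar_mat_def)
  from similar_mat_witD2[OF X this] have
    PQ: "P * Q = 1\<^sub>m n" "Q * P = 1\<^sub>m n" "X = P * Y * Q" and
    c: "P \<in> carrier_mat n n" "Q \<in> carrier_mat n n" by auto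
  show "similar_mat (quat_Phi X) (quat_Phi Y)"
  proof (rule similar_matI[of _ _ "quat_Phi P" "quat_Phi Q" "n + n"])
    show "quat_Phi P * quat_Phi Q = 1\<^sub>m (n + n)" "quat_Phi Q * quat_Phi P = 1\<^sub>m (n + n)"
      using PQ(1,2) c by (simp_all add: quat_Phi_mult[symmetric, of _ n n _ n])
    show "quat_Phi X = quat_Phi P * quat_Phi Y * quat_Phi Q"
      unfolding PQ(3) using c Y by (simp add: quat_Phi_mult[of _ n n _ n] assoc_mult_mat[of _ "n + n" "n + n" _ "n + n" _ "n + n"])
  qed (use X Y c in auto)
next
  assume "similar_mat (quat_Phi X) (quat_Phi Y)"
  then obtain P Q where wit: "similar_mat_wit (quat_Phi X) (quat_Phi Y) P Q" by (auto simp: similar_mat_def)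
  have PX: "quat_Phi X \<in> carrier_mat (n + n) (n + n)" and PY: "quat_Phi Y \<in> carrier_mat (n + n) (n + n)"
    using X Y by auto
  from similar_mat_witD2[OF PX wit] have
    PQ: "P * Q = 1\<^sub>m (n + n)" "Q * P = 1\<^sub>m (n + n)" and XPYQ: "quat_Phi X = P * quat_Phi Y * Q" and
    P: "P \<in> carrier_mat (n + n) (n + n)" and Q: "Q \<in> carrier_mat (n + n) (n + n)" by auto
  have XP: "quat_Phi X * P = P * quat_Phi Y"
  proof -
    have "quat_Phi X * P = P * quat_Phi Y * (Q * P)"
      unfolding XPYQ using P Q PY by (simp add: assoc_mult_mat[of _ "n + n" "n + n" _ "n + n" _ "n + n"])
    then show ?thesis using PQ P PY by (simp add: right_mult_one_mat[of _ "n + n" "n + n"])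
  qed
  obtain A B where A: "A \<in> carrier_mat n n" and B: "B \<in> carrier_mat n n" and
    P_eq: "P = quat_Phi A + \<i> \<cdot>\<^sub>m quat_Phi B"
    using quat_Phi_complexification[OF P] .
  have PA: "quat_Phi A \<in> carrier_mat (n + n) (n + n)" and PB: "quat_Phi B \<in> carrier_mat (n + n) (n + n)"
    using A B by auto
  have "quat_Phi (X * A) + \<i> \<cdot>\<^sub>m quat_Phi (X * B) = quat_Phi (A * Y) + \<i> \<cdot>\<^sub>m quat_Phi (B * Y)"
    using XP PA PB PX PY unfolding P_eq quat_Phi_mult[OF X A] quat_Phi_mult[OF X B]
      quat_Phi_mult[OF A Y] quat_Phi_mult[OF B Y]
    by (simp add: mult_add_distrib_mat[of _ "n + n" "n + n" _ "n + n"] mult_smult_distrib[of _ "n + n" "n + n" _ "n + n"]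
      add_mult_distrib_mat[of _ "n + n" "n + n" _ _ "n + n"] mult_smult_assoc_mat[of _ "n + n" "n + n" _ "n + n"])
  note u = quat_Phi_complexification_unique[OF _ _ _ _ this, of n n]
  have AB: "X * A = A * Y" "X * B = B * Y"
    by (rule u; use A B X Y in auto)+
  have "det P * det Q = 1" using PQ(1) det_mult[OF P Q] by simp
  then have "det (quat_Phi A + \<i> \<cdot>\<^sub>m quat_Phi B) \<noteq> 0" unfolding P_eq by auto
  from exists_real_det_nonzero[OF PA PB this] obtain t :: real where
    t: "det (quat_Phi A + of_real t \<cdot>\<^sub>m quat_Phi B) \<noteq> 0" .
  let ?t = "quat_of_complex (of_real t)"
  define G where "G = A + ?t \<cdot>\<^sub>m B"
  have G: "G \<in> carrier_mat n n" using A B by (auto simp: G_def)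
  have "det (quat_Phi G) \<noteq> 0"
    using t A B by (simp add: G_def quat_Phi_add[of _ n n] quat_Phi_smult_real)
  from quat_mat_invertible[OF G this] obtain H where H: "H \<in> carrier_mat n n" "G * H = 1\<^sub>m n" "H * G = 1\<^sub>m n" .
  have "X * (?t \<cdot>\<^sub>m B) = ?t \<cdot>\<^sub>m (X * B)" "(?t \<cdot>\<^sub>m B) * Y = ?t \<cdot>\<^sub>m (B * Y)"
    by (rule quat_mult_smult_real[OF X B] quat_mult_smult_real[OF B Y])+
  then have "X * G = G * Y"
    using A B X Y AB unfolding G_def
    by (simp add: mult_add_distrib_mat[of _ n n _ n] add_mult_distrib_mat[of _ n n _ _ n])
  then have "X * (G * H) = G * Y * H"
    using X G H Y by (metis assoc_mult_mat)
  then have "X = G * Y * H" using H X by simp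
  then show "similar_mat X Y" by (intro similar_matI[of _ _ G H n]) (use X Y G H in auto)
qed

section \<open>Quaternionic Jordan forms inside complex ones\<close>

lemma map_mat_jordan_matrix:
  assumes "f 0 = 0" "f 1 = 1"
  shows "map_mat f (jordan_matrix xs) = jordan_matrix (map (map_prod id f) xs)"
proof (induction xs)
  case Nil
  then show ?case by (auto simp: jordan_matrix_def)
next
  case (Cons b xs)
  obtain m z where b: "b = (m, z)" by force
  have dim: "sum_list (map (fst \<circ> map_prod id f) xs) = sum_list (map fst xs)"
    by (simp add: o_def)
  have "map_mat f (jordan_block m z) = jordan_block m (f z)"
    by (rule eq_matI) (auto simp: jordan_block_def assms)
  moreover have "map_mat f (0\<^sub>m k l) = 0\<^sub>m k l" for k l
    by (rule eq_matI) (auto simp: assms)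
  ultimately show ?case
    using Cons.IH by (simp add: b jordan_matrix_Cons o_def map_four_block_mat[of _ m m _ "sum_list (map fst xs)" _ "sum_list (map fst xs)"])
qed

abbreviation conj_blocks :: "(nat \<times> complex) list \<Rightarrow> (nat \<times> complex) list" where
  "conj_blocks \<equiv> map (map_prod id cnj)"

lemma quat_Phi_complex:
  assumes "M \<in> carrier_mat n n"
  shows "quat_Phi (map_mat quat_of_complex M)
    = four_block_mat M (0\<^sub>m n n) (0\<^sub>m n n) (map_mat cnj M)"
  unfolding quat_Phi_def
  by (rule cong_four_block_mat) (use assms in \<open>auto simp: quat_of_complex_def intro!: eq_matI\<close>)

lemma quat_Phi_jordan_matrix:
  "quat_Phi (jordan_matrix (map (map_prod id quat_of_complex) xs)) = jordan_matrix (xs @ conj_blocks xs)"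
proof -
  have "quat_of_complex 0 = 0" "quat_of_complex 1 = 1"
    by (simp_all add: quat_of_complex_def quat_ops)
  then show ?thesis
    by (simp add: map_mat_jordan_matrix[symmetric] quat_Phi_complex[OF jordan_matrix_carrier]
      jordan_matrix_append o_def)
qed

text \<open>Similarity can be tested after applying \<open>quat_Phi\<close>, which sends
  the Jordan matrix of \<open>xs\<close> to that of \<open>xs\<close> followed by the
  conjugate blocks. Existence and uniqueness of quaternionic Jordan forms thereby become
  questions about the complex Jordan form of \<open>quat_Phi X\<close>.\<close>

lemma quat_jordan_nf_iff:
  assumes X: "X \<in> carrier_mat n n"
  shows "quat_jordan_nf X xs \<longleftrightarrow>
    (\<forall>b\<in>set xs. 0 \<le> Im (snd b)) \<and> jordan_nf (quat_Phi X) (xs @ conj_blocks xs)"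
proof -
  let ?J = "jordan_matrix (map (map_prod id quat_of_complex) xs)"
  have dim: "sum_list (map fst xs) = n" if "similar_mat X ?J \<or> similar_mat (quat_Phi X) (quat_Phi ?J)"
    using that
  proof
    assume "similar_mat X ?J"
    then obtain k where "{X, ?J} \<subseteq> carrier_mat k k" using similar_matD by blast
    then show ?thesis using X unfolding carrier_mat_def by (simp add: o_def)
  next
    assume "similar_mat (quat_Phi X) (quat_Phi ?J)"
    then obtain k where "{quat_Phi X, quat_Phi ?J} \<subseteq> carrier_mat k k" using similar_matD by blast
    then show ?thesis using X unfolding carrier_mat_def by (simp add: o_def)
  qed
  have sim: "similar_mat X ?J \<longleftrightarrow> similar_mat (quat_Phi X) (quat_Phi ?J)"
  proof (cases "sum_list (map fst xs) = n")
    case True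
    have "?J \<in> carrier_mat n n"
      using True by (auto simp: o_def)
    then show ?thesis using quat_similar_iff_Phi_similar[OF X] by blast
  qed (use dim in blast)
  have maps: "map (\<lambda>(m, z). (m, quat_of_complex z)) xs = map (map_prod id quat_of_complex) xs"
    by auto
  have im: "(\<forall>(m, z)\<in>set xs. 0 \<le> Im z) \<longleftrightarrow> (\<forall>b\<in>set xs. 0 \<le> Im (snd b))" by auto
  have sizes: "0 \<in> fst ` set (map (map_prod id quat_of_complex) xs) \<longleftrightarrow> 0 \<in> fst ` set xs"
     "0 \<in> fst ` set (xs @ conj_blocks xs) \<longleftrightarrow> 0 \<in> fst ` set xs"
    by force+
  show ?thesis
    unfolding quat_jordan_nf_def jordan_nf_def maps sizes sim im quat_Phi_jordan_matrix ..
qed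

lemma block_sizes_conj: "block_sizes (conj_blocks xs) z = block_sizes xs (cnj z)"
proof -
  have "inj cnj" by (auto simp: inj_def)
  from block_sizes_map_inj[OF this, of xs "cnj z"] show ?thesis by simp
qed

abbreviation upper_rep :: "complex \<Rightarrow> complex" where
  "upper_rep z \<equiv> (if 0 \<le> Im z then z else cnj z)"

text \<open>At a real number both halves contribute the same blocks, which are therefore
  doubled; elsewhere only one half contributes, because the representatives lie in the
  closed upper half plane.\<close>

lemma block_sizes_append_conj:
  assumes "\<forall>b\<in>set xs. 0 \<le> Im (snd b)"
  shows "block_sizes (xs @ conj_blocks xs) z =
    (if Im z = 0 then block_sizes xs z + block_sizes xs z else block_sizes xs (upper_rep z))"
proof -
  have "block_sizes xs w = {#}" if "Im w < 0" for w
    using assms that unfolding block_sizes_empty_iff by force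
  moreover have "cnj z = z" if "Im z = 0" using that by (simp add: complex_eq_iff)
  ultimately show ?thesis by (auto simp: block_sizes_append block_sizes_conj)
qed

lemma quat_jordan_nf_unique:
  assumes X: "X \<in> carrier_mat n n" and xs: "quat_jordan_nf X xs" and ys: "quat_jordan_nf X ys"
  shows "mset xs = mset ys"
proof -
  let ?P = "\<lambda>xs z. block_sizes (xs @ conj_blocks xs) z"
  note xs' = xs[unfolded quat_jordan_nf_iff[OF X]] and ys' = ys[unfolded quat_jordan_nf_iff[OF X]]
  have eq: "?P xs z = ?P ys z" for z
    using jordan_nf_mset_unique[OF conjunct2[OF xs'] conjunct2[OF ys']]
    by (simp only: block_sizes_eq_iff_mset_eq[symmetric])
  have "block_sizes xs z = block_sizes ys z" for z
  proof (cases "Im z < 0")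
    case True
    then have "z \<notin> snd ` set xs" "z \<notin> snd ` set ys" using xs' ys' by force+
    then show ?thesis by (metis block_sizes_empty_iff)
  next
    case False
    then show ?thesis
      using eq[of z] xs' ys' by (auto simp: block_sizes_append_conj multiset_add_self_eq_iff split: if_splits)
  qed
  then show ?thesis using block_sizes_eq_iff_mset_eq by blast
qed

lemma partition_quat_eq:
  assumes X: "X \<in> carrier_mat n n" and xs: "quat_jordan_nf X xs"
  shows "partition_quat X (rep_class z) = block_sizes xs (upper_rep z)"
  unfolding partition_quat_def complex_rep_eq
proof (rule the_equality)
  fix d assume "\<exists>n_as. quat_jordan_nf X n_as \<and> d = block_sizes n_as (upper_rep z)"
  then show "d = block_sizes xs (upper_rep z)"
    using quat_jordan_nf_unique[OF X xs] block_sizes_eq_iff_mset_eq by metis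
qed (use xs in blast)

section \<open>Kernels of quaternionic matrices have even complex dimension\<close>

text \<open>Right multiplication by \<open>- quat_j\<close> on quaternionic column
  vectors, in the coordinates in which \<open>a + b quat_j\<close> is the complex column
  \<open>(a, - cnj b)\<close>. It is antilinear and commutes with
  \<open>quat_Phi A\<close>.\<close>

definition quat_struct :: "nat \<Rightarrow> complex vec \<Rightarrow> complex vec" where
  "quat_struct n v = vec (n + n) (\<lambda>i. if i < n then - cnj (v $ (n + i)) else cnj (v $ (i - n)))"

lemma quat_struct_carrier [simp]: "quat_struct n v \<in> carrier_vec (n + n)"
  by (simp add: quat_struct_def)

lemma quat_struct_dim [simp]: "dim_vec (quat_struct n v) = n + n"
  by (simp add: quat_struct_def)

lemma quat_struct_index: "i < n \<Longrightarrow> quat_struct n v $ i = - cnj (v $ (n + i))"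
  "i < n \<Longrightarrow> quat_struct n v $ (n + i) = cnj (v $ i)"
  "i < n \<Longrightarrow> quat_struct n v $ (i + n) = cnj (v $ i)"
  by (simp_all add: quat_struct_def)

lemma quat_struct_add:
  "v \<in> carrier_vec (n + n) \<Longrightarrow> w \<in> carrier_vec (n + n) \<Longrightarrow>
     quat_struct n (v + w) = quat_struct n v + quat_struct n w"
  by (rule eq_vecI) (auto simp: quat_struct_def)

lemma quat_struct_smult:
  "v \<in> carrier_vec (n + n) \<Longrightarrow> quat_struct n (c \<cdot>\<^sub>v v) = cnj c \<cdot>\<^sub>v quat_struct n v"
  by (rule eq_vecI) (auto simp: quat_struct_def)

lemma quat_struct_square:
  "v \<in> carrier_vec (n + n) \<Longrightarrow> quat_struct n (quat_struct n v) = - v"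
  by (rule eq_vecI) (auto simp: quat_struct_def)

lemma quat_Phi_mult_vec_index:
  assumes A: "A \<in> carrier_mat n n" and v: "v \<in> carrier_vec (n + n)" and i: "i < n"
  shows "(quat_Phi A *\<^sub>v v) $ i
      = (\<Sum>k = 0..<n. cpart (A $$ (i, k)) * v $ k + jpart (A $$ (i, k)) * v $ (n + k))"
    and "(quat_Phi A *\<^sub>v v) $ (n + i)
      = (\<Sum>k = 0..<n. cnj (cpart (A $$ (i, k))) * v $ (n + k) - cnj (jpart (A $$ (i, k))) * v $ k)"
proof -
  have split: "sum f {0..<n + n} = (\<Sum>k = 0..<n. f k) + (\<Sum>k = 0..<n. f (n + k))" for f :: "nat \<Rightarrow> complex"
    using sum.atLeastLessThan_concat[of 0 n "n + n" f] sum.shift_bounds_nat_ivl[of f 0 n n]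
    by (simp add: add.commute)
  have dims: "dim_row A = n" "dim_col A = n" "dim_vec v = n + n" using A v by auto
  show "(quat_Phi A *\<^sub>v v) $ i
      = (\<Sum>k = 0..<n. cpart (A $$ (i, k)) * v $ k + jpart (A $$ (i, k)) * v $ (n + k))"
    using i quat_Phi_index[of i A] by (simp add: scalar_prod_def split dims sum.distrib)
  show "(quat_Phi A *\<^sub>v v) $ (n + i)
      = (\<Sum>k = 0..<n. cnj (cpart (A $$ (i, k))) * v $ (n + k) - cnj (jpart (A $$ (i, k))) * v $ k)"
    using i quat_Phi_index[of i A] by (simp add: scalar_prod_def split dims sum_subtractf sum_negf)
qed

lemma quat_Phi_mult_struct:
  assumes A: "A \<in> carrier_mat n n" and v: "v \<in> carrier_vec (n + n)"
  shows "quat_Phi A *\<^sub>v quat_struct n v = quat_struct n (quat_Phi A *\<^sub>v v)"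
proof (rule eq_vecI)
  fix i assume "i < dim_vec (quat_struct n (quat_Phi A *\<^sub>v v))"
  then have i: "i < n + n" by (simp add: quat_struct_def)
  have [simp]: "dim_row A = n" using A by simp
  show "(quat_Phi A *\<^sub>v quat_struct n v) $ i = quat_struct n (quat_Phi A *\<^sub>v v) $ i"
  proof (cases "i < n")
    case True
    then show ?thesis
      by (simp only: quat_struct_index quat_Phi_mult_vec_index[OF A] v quat_struct_carrier)
        (simp add: quat_struct_index sum_negf[symmetric] algebra_simps)
  next
    case False
    then obtain j where j: "i = n + j" "j < n" using i by (metis add_less_cancel_left le_iff_add not_less)
    then show ?thesis
      by (simp only: quat_struct_index quat_Phi_mult_vec_index[OF A] v quat_struct_carrier)
        (simp add: quat_struct_index sum_negf[symmetric] algebra_simps)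
  qed
qed (use A in \<open>auto simp: quat_struct_def\<close>)

lemma (in vectorspace) mem_span_insert_iff:
  assumes fin: "finite S" and S: "S \<subseteq> carrier V" and w: "w \<in> carrier V" "w \<notin> S"
  shows "u \<in> span (insert w S) \<longleftrightarrow> (\<exists>c\<in>carrier K. \<exists>s\<in>span S. u = c \<odot>\<^bsub>V\<^esub> w \<oplus>\<^bsub>V\<^esub> s)"
proof
  assume "u \<in> span (insert w S)"
  then obtain a where a: "a \<in> insert w S \<rightarrow> carrier K" and u: "lincomb a (insert w S) = u"
    using finite_in_span[of "insert w S" u] fin S w by auto
  have "u = a w \<odot>\<^bsub>V\<^esub> w \<oplus>\<^bsub>V\<^esub> lincomb a S"
    using lincomb_insert[of S a w] fin S w a u by simp
  moreover have "lincomb a S \<in> span S" unfolding span_def using fin a by blast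
  ultimately show "\<exists>c\<in>carrier K. \<exists>s\<in>span S. u = c \<odot>\<^bsub>V\<^esub> w \<oplus>\<^bsub>V\<^esub> s" using a by auto
next
  assume "\<exists>c\<in>carrier K. \<exists>s\<in>span S. u = c \<odot>\<^bsub>V\<^esub> w \<oplus>\<^bsub>V\<^esub> s"
  then obtain c s where cs: "c \<in> carrier K" "s \<in> span S" "u = c \<odot>\<^bsub>V\<^esub> w \<oplus>\<^bsub>V\<^esub> s" by blast
  have sub: "insert w S \<subseteq> carrier V" using S w by auto
  interpret sp: submodule K "span (insert w S)" V by (rule span_is_submodule[OF sub])
  show "u \<in> span (insert w S)"
    unfolding cs(3) using cs(1,2) span_mem[OF sub] span_is_monotone[of S "insert w S"] by blast
qed

text \<open>The kernel is a quaternionic vector space. Take a maximal independent set of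
  even size whose span is stable under the antilinear map
  \<open>J = quat_struct n\<close>. If a kernel vector \<open>w\<close> were outside the
  span, then \<open>w\<close> and \<open>J w\<close> could both be added: from
  \<open>J w = d w + s\<close> with \<open>s\<close> in the span, applying
  \<open>J\<close> once more gives \<open>- w = cnj d J w + \<dots>\<close>, hence
  \<open>(1 + |d|^2) w\<close> is in the span, and so is \<open>w\<close>.\<close>

lemma kernel_dim_quat_Phi_even:
  assumes A: "A \<in> carrier_mat n n"
  shows "even (kernel_dim (quat_Phi A))"
proof -
  let ?J = "quat_struct n"
  have PA: "quat_Phi A \<in> carrier_mat (n + n) (n + n)" using A by simp
  interpret K: kernel "n + n" "n + n" "quat_Phi A" by unfold_locales (rule PA)
  let ?W = "mat_kernel (quat_Phi A)"
  have W: "v \<in> carrier_vec (n + n)" if "v \<in> ?W" for v using mat_kernelD[OF PA that] by simp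
  have JW: "?J v \<in> ?W" if "v \<in> ?W" for v
    using mat_kernelD[OF PA that] quat_Phi_mult_struct[OF A, of v]
    by (intro mat_kernelI[OF PA]) (auto simp: quat_struct_def intro!: eq_vecI)
  obtain B where B: "finite B" "K.basis B" using kernel_basis_exists[OF PA] by blast
  have fd: "K.Ker.fin_dim"
    using B unfolding K.Ker.fin_dim_def K.Ker.basis_def by auto
  define good where "good S \<longleftrightarrow> S \<subseteq> ?W \<and> K.lin_indpt S \<and> even (card S) \<and> (\<forall>v\<in>K.span S. ?J v \<in> K.span S)" for S
  have "finite S \<and> card S \<le> K.dim" if "good S" for S
    using that K.Ker.li_le_dim[OF fd] unfolding good_def by auto
  moreover have "good {}"
    unfolding good_def K.Ker.span_empty K.Ker.lin_dep_def by (auto simp: quat_struct_def intro!: eq_vecI)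
  ultimately obtain S where S: "finite S" "maximal S good" using maximal_exists[of good] by metis
  then have "good S" by (simp add: maximal_def)
  then have SW: "S \<subseteq> ?W" and ind: "K.lin_indpt S" and ev: "even (card S)"
    and JS: "\<And>v. v \<in> K.span S \<Longrightarrow> ?J v \<in> K.span S"
    unfolding good_def by auto
  interpret sp: submodule class_ring "K.span S" K.VK
    by (rule K.Ker.span_is_submodule) (use SW in simp)
  have add: "v + w \<in> K.span S" if "v \<in> K.span S" "w \<in> K.span S" for v w
    using sp.m_closed[of v w] that by simp
  have smult: "c \<cdot>\<^sub>v v \<in> K.span S" if "v \<in> K.span S" for c v
    using sp.smult_closed[of c v] that by (simp add: class_ring_simps)
  have span_W: "v \<in> ?W" if "v \<in> K.span S" for v
    using K.Ker.span_closed[OF SW that] .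
  \<comment> \<open>Maximality of the set is contradicted by adjoining a missing vector and its image.\<close>
  have "?W \<subseteq> K.span S"
  proof
    fix w assume w: "w \<in> ?W"
    show "w \<in> K.span S"
    proof (rule ccontr)
      assume nw: "w \<notin> K.span S"
      let ?S1 = "insert w S" and ?S2 = "insert (?J w) (insert w S)"
      note wc = W[OF w] W[OF JW[OF w]]
      have S1: "?S1 \<subseteq> ?W" "finite ?S1" and wS: "w \<notin> S"
        using w SW S(1) nw K.Ker.span_mem[OF SW] by auto
      have span1: "u \<in> K.span ?S1 \<longleftrightarrow> (\<exists>c. \<exists>s\<in>K.span S. u = c \<cdot>\<^sub>v w + s)" for u
        using K.Ker.mem_span_insert_iff[OF S(1) SW w wS, of u] by simp
      have nJ: "?J w \<notin> K.span ?S1"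
      proof
        assume "?J w \<in> K.span ?S1"
        then obtain d s where s: "s \<in> K.span S" and Jw: "?J w = d \<cdot>\<^sub>v w + s" using span1 by blast
        note sc = W[OF span_W[OF s]] W[OF span_W[OF JS[OF s]]]
        have "- w = cnj d \<cdot>\<^sub>v (d \<cdot>\<^sub>v w + s) + ?J s"
          unfolding Jw[symmetric] using quat_struct_square[OF wc(1)] wc sc
          by (subst quat_struct_smult[symmetric], simp) (simp add: Jw quat_struct_add quat_struct_smult)
        note eq = this
        define N where "N = 1 + cnj d * d"
        have "N = of_real (1 + (cmod d)\<^sup>2)"
          unfolding N_def by (simp add: complex_norm_square mult.commute del: of_real_power)
        moreover have "1 + (cmod d)\<^sup>2 \<noteq> 0" by (smt (verit) zero_le_power2)
        ultimately have N: "N \<noteq> 0" by (metis of_real_eq_0_iff)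
        have "w = (- 1 / N) \<cdot>\<^sub>v (cnj d \<cdot>\<^sub>v s + ?J s)"
        proof (rule eq_vecI)
          fix i assume "i < dim_vec ((- 1 / N) \<cdot>\<^sub>v (cnj d \<cdot>\<^sub>v s + ?J s))"
          then have i: "i < n + n" by (simp add: quat_struct_def)
          have "- (w $ i) = cnj d * (d * w $ i + s $ i) + ?J s $ i"
            using arg_cong[OF eq, of "\<lambda>v. v $ i"] i wc sc by simp
          note e = this
          have "w $ i * N + (cnj d * s $ i + ?J s $ i) = w $ i + (cnj d * (d * w $ i + s $ i) + ?J s $ i)"
            unfolding N_def by (simp add: algebra_simps)
          also have "\<dots> = 0" unfolding e[symmetric] by simp
          finally have "w $ i = - (cnj d * s $ i + ?J s $ i) / N"
            by (simp only: nonzero_eq_divide_eq[OF N] eq_neg_iff_add_eq_0)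
          also have "\<dots> = ((- 1 / N) \<cdot>\<^sub>v (cnj d \<cdot>\<^sub>v s + ?J s)) $ i"
            using i sc by (simp add: diff_divide_distrib add_divide_distrib)
          finally show "w $ i = ((- 1 / N) \<cdot>\<^sub>v (cnj d \<cdot>\<^sub>v s + ?J s)) $ i" .
        qed (use wc in \<open>simp add: quat_struct_def\<close>)
        moreover have "(- 1 / N) \<cdot>\<^sub>v (cnj d \<cdot>\<^sub>v s + ?J s) \<in> K.span S"
          by (intro smult add JS s)
        ultimately show False using nw by simp
      qed
      have JwS: "?J w \<notin> ?S1" using nJ K.Ker.span_mem[OF S1(1)] by blast
      have span2: "u \<in> K.span ?S2 \<longleftrightarrow> (\<exists>c d. \<exists>s\<in>K.span S. u = c \<cdot>\<^sub>v ?J w + (d \<cdot>\<^sub>v w + s))" for u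
      proof -
        have "u \<in> K.span ?S2 \<longleftrightarrow> (\<exists>c. \<exists>t\<in>K.span ?S1. u = c \<cdot>\<^sub>v ?J w + t)"
          using K.Ker.mem_span_insert_iff[OF S1(2) S1(1) JW[OF w] JwS, of u] by simp
        then show ?thesis unfolding span1 Bex_def by metis
      qed
      have "\<not> K.lin_dep ?S1"
        using K.Ker.lin_dep_iff_in_span[OF SW ind w wS] nw by simp
      then have ind2: "\<not> K.lin_dep ?S2"
        using K.Ker.lin_dep_iff_in_span[OF S1(1) _ JW[OF w] JwS] nJ by simp
      have "?J u \<in> K.span ?S2" if "u \<in> K.span ?S2" for u
      proof -
        obtain c d s where s: "s \<in> K.span S" and u: "u = c \<cdot>\<^sub>v ?J w + (d \<cdot>\<^sub>v w + s)"
          using \<open>u \<in> K.span ?S2\<close> span2 by blast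
        note sc = W[OF span_W[OF s]] W[OF span_W[OF JS[OF s]]]
        have "?J u = cnj c \<cdot>\<^sub>v (- w) + (cnj d \<cdot>\<^sub>v ?J w + ?J s)"
          unfolding u using wc sc by (simp add: quat_struct_add quat_struct_smult quat_struct_square)
        also have "\<dots> = cnj d \<cdot>\<^sub>v ?J w + ((- cnj c) \<cdot>\<^sub>v w + ?J s)"
          using wc sc by (intro eq_vecI) auto
        finally show ?thesis unfolding span2 using JS[OF s] by blast
      qed
      moreover have "even (card ?S2)" using ev S(1) wS JwS by simp
      ultimately have "good ?S2" unfolding good_def using S1(1) JW[OF w] ind2 by simp
      moreover have "S \<subseteq> ?S2" by (intro subset_insertI2 subset_refl)
      moreover have "\<forall>B. S \<subseteq> B \<and> good B \<longrightarrow> B = S"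
        using S(2) unfolding maximal_def by (rule conjunct2)
      ultimately have "?S2 = S" by (metis (no_types))
      then have "w \<in> S" by (metis (no_types) insertI1 insertI2)
      then show False using wS by contradiction
    qed
  qed
  then have "K.basis S"
    using ind SW span_W unfolding K.Ker.basis_def by auto
  then have "K.dim = card S" by (rule K.Ker.dim_basis[OF S(1)])
  then show ?thesis using ev by simp
qed

lemma quat_Phi_pow:
  "A \<in> carrier_mat n n \<Longrightarrow> quat_Phi (A ^\<^sub>m k) = quat_Phi A ^\<^sub>m k"
  by (induction k) (auto simp: quat_Phi_mult[of _ n n _ n])

lemma dim_gen_eigenspace_quat_Phi_even:
  assumes X: "X \<in> carrier_mat n n" and z: "Im z = 0"
  shows "even (dim_gen_eigenspace (quat_Phi X) z k)"
proof -
  let ?Y = "X + quat_of_complex (- z) \<cdot>\<^sub>m 1\<^sub>m n"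
  have Y: "?Y \<in> carrier_mat n n" using X by auto
  have "char_matrix (quat_Phi X) z = quat_Phi ?Y"
  proof -
    have "- z = of_real (- Re z)" using z by (simp add: complex_eq_iff)
    then have "quat_Phi (quat_of_complex (- z) \<cdot>\<^sub>m 1\<^sub>m n) = (- z) \<cdot>\<^sub>m 1\<^sub>m (n + n)"
      by (metis quat_Phi_smult_real quat_Phi_one)
    then show ?thesis unfolding char_matrix_def using X by (simp add: quat_Phi_add[of _ n n])
  qed
  then show ?thesis
    unfolding dim_gen_eigenspace_def
    using kernel_dim_quat_Phi_even[of "?Y ^\<^sub>m k" n] Y by (simp add: quat_Phi_pow[OF Y])
qed

text \<open>For real \<open>z\<close> the matrix \<open>quat_Phi X - z\<close> is again
  of the form \<open>quat_Phi Y\<close>, so all kernel dimensions that count the blocks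
  at \<open>z\<close> are even.\<close>

lemma quat_Phi_block_sizes_real_even:
  assumes X: "X \<in> carrier_mat n n" and xs: "jordan_nf (quat_Phi X) xs" and z: "Im z = 0"
  shows "even (count (mset xs) (k, z))"
proof (cases "k = 0")
  case True
  then have "(k, z) \<notin> set xs" using xs unfolding jordan_nf_def by force
  then have "count (mset xs) (k, z) = 0" by (metis count_mset_0_iff)
  then show ?thesis by presburger
next
  case False
  have "count (mset xs) (k, z) = compute_nr_of_jordan_blocks (quat_Phi X) z k"
    using compute_nr_of_jordan_blocks[OF xs False, of z]
    by (simp add: count_mset count_list_eq_length_filter)
  then show ?thesis
    unfolding compute_nr_of_jordan_blocks_def
    by (simp add: dim_gen_eigenspace_quat_Phi_even[OF X z] even_diff_nat)
qed

section \<open>Existence of quaternionic Jordan forms\<close>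

lemma similar_mat_map_cnj:
  assumes "similar_mat A B"
  shows "similar_mat (map_mat cnj A) (map_mat cnj B)"
proof -
  interpret cnj: comm_ring_hom cnj by unfold_locales auto
  obtain n P Q where "{A, B, P, Q} \<subseteq> carrier_mat n n" and
    PQ: "P * Q = 1\<^sub>m n" "Q * P = 1\<^sub>m n" "A = P * B * Q"
    using similar_matD[OF assms] by blast
  then have c: "A \<in> carrier_mat n n" "B \<in> carrier_mat n n" "P \<in> carrier_mat n n" "Q \<in> carrier_mat n n"
    by auto
  show ?thesis
  proof (rule similar_matI)
    show "map_mat cnj P * map_mat cnj Q = 1\<^sub>m n"  "map_mat cnj Q * map_mat cnj P = 1\<^sub>m n"
      unfolding cnj.mat_hom_mult[OF c(3,4), symmetric] cnj.mat_hom_mult[OF c(4,3), symmetric] PQ(1,2)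
      by (rule cnj.mat_hom_one)+
    show "map_mat cnj A = map_mat cnj P * map_mat cnj B * map_mat cnj Q"
      unfolding PQ(3) cnj.mat_hom_mult[OF mult_carrier_mat[OF c(3,2)] c(4)] cnj.mat_hom_mult[OF c(3,2)] ..
  qed (use c in auto)
qed

text \<open>The conjugating matrix is that of \<open>quat_struct n\<close> composed with
  entrywise conjugation.\<close>

lemma quat_Phi_similar_cnj:
  assumes X: "X \<in> carrier_mat n n"
  shows "similar_mat (quat_Phi X) (map_mat cnj (quat_Phi X))"
proof -
  let ?P = "four_block_mat (0\<^sub>m n n) (- 1\<^sub>m n) (1\<^sub>m n) (0\<^sub>m n n) :: complex mat"
  let ?Q = "four_block_mat (0\<^sub>m n n) (1\<^sub>m n) (- 1\<^sub>m n) (0\<^sub>m n n) :: complex mat"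
  show ?thesis
  proof (rule similar_matI[of _ _ ?P ?Q "n + n"])
    have [simp]: "- (1\<^sub>m n) * - (1\<^sub>m n) = (1\<^sub>m n :: complex mat)" "- 0\<^sub>m n n = (0\<^sub>m n n :: complex mat)"
      by (auto intro!: eq_matI)
    show "?P * ?Q = 1\<^sub>m (n + n)"
      by (subst mult_four_block_mat[of _ n n _ n _ n _ _ n _ n]) auto
    show "?Q * ?P = 1\<^sub>m (n + n)"
      by (subst mult_four_block_mat[of _ n n _ n _ n _ _ n _ n]) auto
    define A B where "A = map_mat cpart X" and "B = map_mat jpart X"
    have AB: "A \<in> carrier_mat n n" "B \<in> carrier_mat n n" using X by (auto simp: A_def B_def)
    have "map_mat cnj (quat_Phi X) = four_block_mat (map_mat cnj A) (map_mat cnj B) (- B) A"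
      unfolding quat_Phi_def A_def[symmetric] B_def[symmetric]
      using AB by (intro eq_matI) auto
    moreover have "?P * four_block_mat (map_mat cnj A) (map_mat cnj B) (- B) A
        = four_block_mat B (- A) (map_mat cnj A) (map_mat cnj B)"
      using AB by (subst mult_four_block_mat[of _ n n _ n _ n _ _ n _ n]) (auto intro!: cong_four_block_mat eq_matI)
    moreover have "four_block_mat B (- A) (map_mat cnj A) (map_mat cnj B) * ?Q
        = four_block_mat A B (- map_mat cnj B) (map_mat cnj A)"
      using AB by (subst mult_four_block_mat[of _ n n _ n _ n _ _ n _ n]) (auto intro!: cong_four_block_mat eq_matI)
    ultimately show "quat_Phi X = ?P * map_mat cnj (quat_Phi X) * ?Q"
      unfolding quat_Phi_def A_def[symmetric] B_def[symmetric] by simp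
  qed (use X in auto)
qed

lemma jordan_nf_perm:
  fixes A :: "'a :: field mat"
  assumes xs: "jordan_nf A xs" and eq: "mset xs = mset ys"
  shows "jordan_nf A ys"
  unfolding jordan_nf_def
proof
  have "set xs = set ys" using eq by (rule mset_eq_setD)
  then show "0 \<notin> fst ` set ys" using xs unfolding jordan_nf_def by simp
  show "similar_mat A (jordan_matrix ys)"
    using xs jordan_matrix_similar_perm[OF eq] similar_mat_trans unfolding jordan_nf_def by blast
qed

lemma quat_Phi_count_cnj:
  assumes X: "X \<in> carrier_mat n n" and xs: "jordan_nf (quat_Phi X) xs"
  shows "count (mset xs) (k, cnj z) = count (mset xs) (k, z)"
proof -
  have "similar_mat (map_mat cnj (quat_Phi X)) (jordan_matrix (conj_blocks xs))"
    using similar_mat_map_cnj[of "quat_Phi X" "jordan_matrix xs"] xs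
    unfolding jordan_nf_def by (simp add: map_mat_jordan_matrix)
  then have "similar_mat (quat_Phi X) (jordan_matrix (conj_blocks xs))"
    using quat_Phi_similar_cnj[OF X] similar_mat_trans by blast
  moreover have "0 \<notin> fst ` set (conj_blocks xs)"
    using xs unfolding jordan_nf_def by force
  ultimately have "jordan_nf (quat_Phi X) (conj_blocks xs)" unfolding jordan_nf_def by blast
  from jordan_nf_mset_unique[OF xs this]
  show ?thesis by (metis block_sizes_conj count_block_sizes)
qed

text \<open>Keep the blocks of \<open>quat_Phi X\<close> with eigenvalue in the open
  upper half plane, and half of those with real eigenvalue; conjugation symmetry and
  parity show that appending the conjugates restores all blocks.\<close>

lemma quat_jordan_nf_exists:
  assumes X: "X \<in> carrier_mat n n"
  obtains xs where "quat_jordan_nf X xs"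
proof -
  have "quat_Phi X \<in> carrier_mat (n + n) (n + n)" using X by simp
  from complex_jordan_nf_exists[OF this] obtain ys where ys: "jordan_nf (quat_Phi X) ys" .
  define f where "f b = (if Im (snd b) > 0 then count (mset ys) b
    else if Im (snd b) = 0 then count (mset ys) b div 2 else 0)" for b
  obtain xs where xs: "mset xs = (\<Sum>b\<in>set ys. replicate_mset (f b) b)"
    using ex_mset by blast
  have f0: "f b = 0" if "b \<notin> set ys" for b
    using that unfolding f_def by (metis count_mset_0_iff div_0)
  have count_xs: "count (mset xs) b = f b" for b
    unfolding xs count_sum count_replicate_mset by (simp add: sum.delta f0)
  have "0 \<le> Im (snd b)" if "b \<in> set xs" for b
    using that count_xs[of b] unfolding f_def by (auto split: if_splits)
  moreover have "mset (xs @ conj_blocks xs) = mset ys"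
    unfolding block_sizes_eq_iff_mset_eq[symmetric]
  proof (intro allI multiset_eqI)
    fix z k
    have "count (block_sizes (xs @ conj_blocks xs) z) k = f (k, z) + f (k, cnj z)"
      by (simp add: block_sizes_append block_sizes_conj count_block_sizes count_xs)
    also have "\<dots> = count (mset ys) (k, z)"
    proof -
      have "cnj z = z" if "Im z = 0" using that by (simp add: complex_eq_iff)
      then show ?thesis
        using quat_Phi_count_cnj[OF X ys, of k z] quat_Phi_block_sizes_real_even[OF X ys, of z k]
        by (auto simp: f_def mult_2[symmetric])
    qed
    finally show "count (block_sizes (xs @ conj_blocks xs) z) k = count (block_sizes ys z) k"
      by (simp add: count_block_sizes)
  qed
  then have "jordan_nf (quat_Phi X) (xs @ conj_blocks xs)"
    using jordan_nf_perm[OF ys] by metis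
  ultimately have "quat_jordan_nf X xs" unfolding quat_jordan_nf_iff[OF X] by blast
  then show ?thesis by (rule that)
qed

section \<open>Reality under the special linear group is similarity to the negative\<close>

text \<open>By similarity it suffices to consider a complex Jordan matrix
  \<open>J\<close>, where the value is \<open>det J * cnj (det J)\<close>.\<close>

lemma quat_det_real_nonneg:
  assumes "g \<in> carrier_mat n n"
  obtains d :: real where "quat_det g = of_real d" "0 \<le> d"
proof -
  interpret cnj: comm_ring_hom cnj by unfold_locales auto
  obtain xs where xs: "quat_jordan_nf g xs" using quat_jordan_nf_exists[OF assms] .
  let ?J = "jordan_matrix xs"
  have "quat_det g = det (jordan_matrix (xs @ conj_blocks xs))"
    unfolding quat_det_def using xs[unfolded quat_jordan_nf_iff[OF assms]] det_similar
    unfolding jordan_nf_def by blast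
  also have "\<dots> = det ?J * det (jordan_matrix (conj_blocks xs))"
  proof -
    have "sum_list (map fst (conj_blocks xs)) = sum_list (map fst xs)" by (simp add: o_def)
    then show ?thesis
      unfolding jordan_matrix_append
      using det_four_block_mat_upper_right_zero[OF jordan_matrix_carrier[of xs] refl zero_carrier_mat
          jordan_matrix_carrier[of "conj_blocks xs"]] by simp
  qed
  also have "jordan_matrix (conj_blocks xs) = map_mat cnj ?J"
    by (simp add: map_mat_jordan_matrix)
  also have "det ?J * det (map_mat cnj ?J) = of_real ((cmod (det ?J))\<^sup>2)"
    by (simp only: cnj.hom_det complex_norm_square)
  finally show ?thesis by (rule that) simp
qed

lemma GL_iff:
  "g \<in> GL n \<longleftrightarrow> g \<in> carrier_mat n n \<and> (\<exists>h\<in>carrier_mat n n. g * h = 1\<^sub>m n \<and> h * g = 1\<^sub>m n)"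
  unfolding GL_def Units_def by (auto simp: ring_mat_def)

lemma monoid_ring_mat: "monoid (ring_mat TYPE('a :: ring_1) n ())"
  by unfold_locales (auto simp: ring_mat_def)

lemma GL_inv:
  fixes g :: "'a :: ring_1 mat"
  assumes "g \<in> GL n"
  defines "h \<equiv> inv\<^bsub>ring_mat TYPE('a) n ()\<^esub> g"
  shows "h \<in> carrier_mat n n" "g * h = 1\<^sub>m n" "h * g = 1\<^sub>m n"
proof -
  interpret monoid "ring_mat TYPE('a) n ()" by (rule monoid_ring_mat)
  show "h \<in> carrier_mat n n" "g * h = 1\<^sub>m n" "h * g = 1\<^sub>m n"
    using assms(1) Units_inv_closed[of g] Units_l_inv[of g] Units_r_inv[of g]
    unfolding GL_def h_def by (auto simp: ring_mat_def)
qed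

lemma Ad_real_iff_intertwines:
  fixes X :: "'a :: ring_1 mat"
  assumes G: "G \<subseteq> GL n" and X: "X \<in> carrier_mat n n"
  shows "Ad_real n G X \<longleftrightarrow> (\<exists>g\<in>G. - X * g = g * X)"
proof -
  have "- X = g * X * h \<longleftrightarrow> - X * g = g * X"
    if c: "g \<in> carrier_mat n n" "h \<in> carrier_mat n n" and gh: "g * h = 1\<^sub>m n" "h * g = 1\<^sub>m n" for g h
  proof
    assume "- X = g * X * h"
    then have "- X * g = g * X * h * g" by simp
    also have "\<dots> = g * X * (h * g)" using c X by (intro assoc_mult_mat) auto
    also have "\<dots> = g * X" using c X by (simp add: gh)
    finally show "- X * g = g * X" .
  next
    assume "- X * g = g * X"
    then have "g * X * h = - X * g * h" by simp
    also have "\<dots> = - X * (g * h)" using c X by (intro assoc_mult_mat) auto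
    also have "\<dots> = - X" using X by (simp add: gh)
    finally show "- X = g * X * h" by simp
  qed
  note conj_iff = this
  show ?thesis
    unfolding Ad_real_def
  proof (rule bex_cong[OF refl])
    fix g assume "g \<in> G"
    then have g: "g \<in> GL n" using G by blast
    then have "g \<in> carrier_mat n n" unfolding GL_iff by blast
    then show "- X = g * X * inv\<^bsub>ring_mat TYPE('a) n ()\<^esub> g \<longleftrightarrow> - X * g = g * X"
      using GL_inv[OF g] by (intro conj_iff)
  qed
qed

lemma similar_iff_intertwines:
  fixes X :: "'a :: ring_1 mat"
  assumes X: "X \<in> carrier_mat n n"
  shows "similar_mat (- X) X \<longleftrightarrow> (\<exists>g\<in>GL n. - X * g = g * X)"
  unfolding Ad_real_iff_intertwines[OF subset_refl X, symmetric]
proof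
  assume "Ad_real n (GL n) X"
  then obtain g where g: "g \<in> GL n" "- X = g * X * inv\<^bsub>ring_mat TYPE('a) n ()\<^esub> g"
    unfolding Ad_real_def by blast
  then show "similar_mat (- X) X"
    using GL_inv[OF g(1)] GL_iff X by (intro similar_matI[of _ _ g _ n]) auto
next
  assume "similar_mat (- X) X"
  then obtain P Q where wit: "similar_mat_wit (- X) X P Q" by (auto simp: similar_mat_def)
  have "- X \<in> carrier_mat n n" using X by simp
  from similar_mat_witD2[OF this wit]
  have PQ: "P \<in> carrier_mat n n" "Q \<in> carrier_mat n n" "P * Q = 1\<^sub>m n" "Q * P = 1\<^sub>m n" "- X = P * X * Q"
    by auto
  then have "P \<in> GL n" unfolding GL_iff by blast
  moreover have "- X * P = P * X"
  proof -
    have "- X * P = P * X * Q * P" unfolding PQ(5) ..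
    also have "\<dots> = P * X * (Q * P)" using PQ(1,2) X by (intro assoc_mult_mat) auto
    also have "\<dots> = P * X" using PQ(1,4) X by simp
    finally show ?thesis .
  qed
  ultimately show "Ad_real n (GL n) X"
    unfolding Ad_real_iff_intertwines[OF subset_refl X] by blast
qed

text \<open>An intertwiner \<open>g\<close> is rescaled by an \<open>n\<close>-th root
  of \<open>1 / det g\<close>.\<close>

lemma Ad_real_SL_complex_iff:
  assumes X: "X \<in> carrier_mat n n"
  shows "Ad_real n (SL_complex n) X \<longleftrightarrow> similar_mat (- X) X"
proof -
  have SL: "SL_complex n \<subseteq> GL n" unfolding SL_complex_def by auto
  have "\<exists>s\<in>SL_complex n. - X * s = s * X" if g: "g \<in> GL n" and gX: "- X * g = g * X" for g
  proof -
    have gc: "g \<in> carrier_mat n n" using g GL_iff by blast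
    have det: "det g \<noteq> 0"
    proof -
      obtain h where "h \<in> carrier_mat n n" "g * h = 1\<^sub>m n" using g GL_iff by blast
      then have "det g * det h = 1" using det_mult[OF gc, of h] by simp
      then show ?thesis by auto
    qed
    obtain c where c: "c ^ n * det g = 1"
    \<comment> \<open>In dimension 0 there is no root to take, but every determinant is 1.\<close>
    proof (cases "n = 0")
      case True
      then show ?thesis using gc that[of 1] by simp
    next
      case False
      then have "card {z. z ^ n = 1 / det g} = n"
        using det by (intro card_nth_roots) auto
      then have "{z. z ^ n = 1 / det g} \<noteq> {}" using False by (metis card.empty)
      then obtain z where "z ^ n = 1 / det g" by blast
      then show ?thesis using det that[of z] by simp
    qed
    let ?s = "c \<cdot>\<^sub>m g"
    have s: "?s \<in> carrier_mat n n" using gc by simp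
    have det_s: "det ?s = 1" using c gc by simp
    have "det ?s \<noteq> 0" unfolding det_s by (rule one_neq_zero)
    then have "?s \<in> GL n" unfolding GL_def by (rule det_non_zero_imp_unit[OF s])
    moreover have "- X * ?s = ?s * X"
      using gX X gc by (simp add: mult_smult_distrib[of _ n n _ n] mult_smult_assoc_mat[of _ n n _ n])
    ultimately show ?thesis using det_s unfolding SL_complex_def by blast
  qed
  then show ?thesis
    unfolding Ad_real_iff_intertwines[OF SL X] similar_iff_intertwines[OF X] using SL by blast
qed

text \<open>An intertwiner \<open>g\<close> is rescaled by the positive real
  \<open>2 n\<close>-th root of \<open>1 / quat_det g\<close>; reals are the only
  central scalars.\<close>

lemma Ad_real_SL_quat_iff:
  assumes X: "X \<in> carrier_mat n n"
  shows "Ad_real n (SL_quat n) X \<longleftrightarrow> similar_mat (- X) X"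
proof -
  have SL: "SL_quat n \<subseteq> GL n" unfolding SL_quat_def by auto
  have "\<exists>s\<in>SL_quat n. - X * s = s * X" if g: "g \<in> GL n" and gX: "- X * g = g * X" for g
  proof -
    have gc: "g \<in> carrier_mat n n" using g GL_iff by blast
    obtain d where d: "quat_det g = of_real d" "0 \<le> d" using quat_det_real_nonneg[OF gc] .
    have "quat_det g \<noteq> 0"
    proof -
      obtain h where h: "h \<in> carrier_mat n n" "g * h = 1\<^sub>m n" using g GL_iff by blast
      have "quat_Phi g * quat_Phi h = 1\<^sub>m (n + n)" using quat_Phi_mult[OF gc h(1)] h(2) by simp
      then have "det (quat_Phi g) * det (quat_Phi h) = 1"
        using det_mult[of "quat_Phi g" "n + n" "quat_Phi h"] gc h(1) by simp
      then show ?thesis unfolding quat_det_def by auto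
    qed
    then have d0: "d > 0" using d by auto
    obtain r :: real where r: "r ^ (n + n) * d = 1"
    \<comment> \<open>As in the complex case, dimension 0 allows no root and needs none.\<close>
    proof (cases "n = 0")
      case True
      then have "quat_Phi g \<in> carrier_mat 0 0" using gc quat_Phi_carrier[of g 0 0] by simp
      then have "d = 1" using d(1) unfolding quat_det_def by simp
      then show ?thesis using True that[of 1] by simp
    next
      case False
      then have "root (n + n) (1 / d) ^ (n + n) = 1 / d" using d0 by (intro real_root_pow_pos2) auto
      then show ?thesis using d0 that[of "root (n + n) (1 / d)"] by simp
    qed
    let ?s = "quat_of_complex (of_real r) \<cdot>\<^sub>m g"
    have s: "?s \<in> carrier_mat n n" using gc by simp
    have "quat_det ?s = of_real (r ^ (n + n) * d)"
      using d(1) gc unfolding quat_det_def quat_Phi_smult_real by simp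
    then have det_s: "quat_det ?s = 1" unfolding r by simp
    then have "det (quat_Phi ?s) \<noteq> 0" unfolding quat_det_def by simp
    from quat_mat_invertible[OF s this] have "?s \<in> GL n" using s unfolding GL_iff by metis
    moreover have "- X * ?s = ?s * X"
      using gX X gc by (simp add: quat_mult_smult_real[of _ n n _ n])
    ultimately show ?thesis using det_s unfolding SL_quat_def by blast
  qed
  then show ?thesis
    unfolding Ad_real_iff_intertwines[OF SL X] similar_iff_intertwines[OF X] using SL by blast
qed

section \<open>Right eigenvalues and eigenvalue classes\<close>

text \<open>The first column of \<open>quat_Phi\<close> applied to the column vector
  \<open>w\<close>. Passing to this column turns right multiplication by a complex
  number into ordinary scalar multiplication.\<close>

definition complex_column :: "nat \<Rightarrow> quat vec \<Rightarrow> complex vec" where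
  "complex_column n w = vec (n + n) (\<lambda>i. if i < n then cpart (w $ i) else - cnj (jpart (w $ (i - n))))"

lemma complex_column_index:
  "i < n \<Longrightarrow> complex_column n w $ i = cpart (w $ i)"
  "i < n \<Longrightarrow> complex_column n w $ (n + i) = - cnj (jpart (w $ i))"
  by (simp_all add: complex_column_def)

lemma complex_column_carrier [simp]: "complex_column n w \<in> carrier_vec (n + n)"
  by (simp add: complex_column_def)

lemma complex_column_inj:
  assumes "v \<in> carrier_vec n" "w \<in> carrier_vec n" "complex_column n v = complex_column n w"
  shows "v = w"
proof (rule eq_vecI)
  fix i assume "i < dim_vec w"
  then have i: "i < n" using assms by simp
  have "cpart (v $ i) = cpart (w $ i)"
    using complex_column_index(1)[OF i] assms(3) by metis
  moreover have "- cnj (jpart (v $ i)) = - cnj (jpart (w $ i))"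
    using complex_column_index(2)[OF i] assms(3) by metis
  ultimately show "v $ i = w $ i" by (simp add: quat_eq_iff)
qed (use assms in auto)

lemma complex_column_surj:
  assumes "v \<in> carrier_vec (n + n)"
  obtains w where "w \<in> carrier_vec n" "complex_column n w = v"
proof
  show "complex_column n (vec n (\<lambda>i. Quat (v $ i) (- cnj (v $ (n + i))))) = v"
    using assms by (intro eq_vecI) (auto simp: complex_column_def)
qed simp

lemma complex_column_zero [simp]: "complex_column n (0\<^sub>v n) = 0\<^sub>v (n + n)"
  by (rule eq_vecI) (auto simp: complex_column_def)

lemma complex_column_mult_mat_vec:
  assumes X: "X \<in> carrier_mat n n" and w: "w \<in> carrier_vec n"
  shows "complex_column n (X *\<^sub>v w) = quat_Phi X *\<^sub>v complex_column n w"
proof (rule eq_vecI)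
  fix i assume "i < dim_vec (quat_Phi X *\<^sub>v complex_column n w)"
  then have i: "i < n + n" using X by simp
  have dims: "dim_row X = n" "dim_col X = n" "dim_vec w = n" using X w by auto
  show "complex_column n (X *\<^sub>v w) $ i = (quat_Phi X *\<^sub>v complex_column n w) $ i"
  proof (cases "i < n")
    case True
    have "cpart ((X *\<^sub>v w) $ i) = (\<Sum>k = 0..<n. cpart (X $$ (i, k)) * cpart (w $ k)
        + jpart (X $$ (i, k)) * - cnj (jpart (w $ k)))"
      using True dims by (simp add: scalar_prod_def cpart_sum)
    also have "\<dots> = (quat_Phi X *\<^sub>v complex_column n w) $ i"
      unfolding quat_Phi_mult_vec_index(1)[OF X complex_column_carrier True]
      by (intro sum.cong) (auto simp: complex_column_index)
    finally show ?thesis by (simp only: complex_column_index True)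
  next
    case False
    then obtain j where j: "i = n + j" "j < n" using i by (metis add_less_cancel_left le_iff_add not_less)
    have "- cnj (jpart ((X *\<^sub>v w) $ j)) = (\<Sum>k = 0..<n. cnj (cpart (X $$ (j, k))) * - cnj (jpart (w $ k))
        - cnj (jpart (X $$ (j, k))) * cpart (w $ k))"
      using j dims by (simp add: scalar_prod_def jpart_sum sum_negf sum_subtractf sum.distrib)
    also have "\<dots> = (quat_Phi X *\<^sub>v complex_column n w) $ (n + j)"
      unfolding quat_Phi_mult_vec_index(2)[OF X complex_column_carrier j(2)]
      by (intro sum.cong) (auto simp: complex_column_index)
    finally show ?thesis by (simp only: complex_column_index j)
  qed
qed (use X in \<open>simp add: complex_column_def\<close>)

lemma complex_column_smult:
  assumes w: "w \<in> carrier_vec n"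
  shows "complex_column n (map_vec (\<lambda>x. x * quat_of_complex z) w) = z \<cdot>\<^sub>v complex_column n w"
  using w by (intro eq_vecI) (auto simp: complex_column_def quat_of_complex_def)

lemma right_eigenvalue_iff_Phi_eigenvalue:
  assumes X: "X \<in> carrier_mat n n"
  shows "right_eigenvalue X (quat_of_complex z) \<longleftrightarrow> eigenvalue (quat_Phi X) z"
proof -
  let ?m = "map_vec (\<lambda>x. x * quat_of_complex z)"
  have iff: "w \<noteq> 0\<^sub>v n \<and> X *\<^sub>v w = ?m w \<longleftrightarrow>
      complex_column n w \<noteq> 0\<^sub>v (n + n) \<and> quat_Phi X *\<^sub>v complex_column n w = z \<cdot>\<^sub>v complex_column n w"
    if w: "w \<in> carrier_vec n" for w
  proof -
    have "w = 0\<^sub>v n \<longleftrightarrow> complex_column n w = 0\<^sub>v (n + n)"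
      using complex_column_inj[OF w zero_carrier_vec] by auto
    moreover have "X *\<^sub>v w = ?m w \<longleftrightarrow> complex_column n (X *\<^sub>v w) = complex_column n (?m w)"
      using complex_column_inj[of "X *\<^sub>v w" n "?m w"] X w by auto
    ultimately show ?thesis
      unfolding complex_column_mult_mat_vec[OF X w] complex_column_smult[OF w] by blast
  qed
  have "dim_row X = n" using X by simp
  then have "right_eigenvalue X (quat_of_complex z) \<longleftrightarrow>
      (\<exists>w\<in>carrier_vec n. w \<noteq> 0\<^sub>v n \<and> X *\<^sub>v w = ?m w)"
    unfolding right_eigenvalue_def by simp
  also have "\<dots> \<longleftrightarrow> (\<exists>v\<in>carrier_vec (n + n). v \<noteq> 0\<^sub>v (n + n) \<and> quat_Phi X *\<^sub>v v = z \<cdot>\<^sub>v v)"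
  proof
    assume "\<exists>w\<in>carrier_vec n. w \<noteq> 0\<^sub>v n \<and> X *\<^sub>v w = ?m w"
    then obtain w where "w \<in> carrier_vec n" "w \<noteq> 0\<^sub>v n \<and> X *\<^sub>v w = ?m w" by blast
    then show "\<exists>v\<in>carrier_vec (n + n). v \<noteq> 0\<^sub>v (n + n) \<and> quat_Phi X *\<^sub>v v = z \<cdot>\<^sub>v v"
      using iff[of w] by (intro bexI[of _ "complex_column n w"]) simp_all
  next
    assume "\<exists>v\<in>carrier_vec (n + n). v \<noteq> 0\<^sub>v (n + n) \<and> quat_Phi X *\<^sub>v v = z \<cdot>\<^sub>v v"
    then obtain v where v: "v \<in> carrier_vec (n + n)"
      "v \<noteq> 0\<^sub>v (n + n) \<and> quat_Phi X *\<^sub>v v = z \<cdot>\<^sub>v v" by blast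
    obtain w where w: "w \<in> carrier_vec n" "complex_column n w = v"
      using complex_column_surj[OF v(1)] .
    show "\<exists>w\<in>carrier_vec n. w \<noteq> 0\<^sub>v n \<and> X *\<^sub>v w = ?m w"
      using iff[OF w(1)] v(2) w(1) unfolding w(2) by blast
  qed
  also have "\<dots> \<longleftrightarrow> eigenvalue (quat_Phi X) z"
    unfolding eigenvalue_def eigenvector_def using X by auto
  finally show ?thesis .
qed

text \<open>If \<open>v\<close> is an eigenvector for \<open>q\<close>, then
  \<open>v u\<close> is one for \<open>inverse u * q * u\<close>.\<close>

lemma right_eigenvalue_class:
  assumes X: "X \<in> carrier_mat n n" and q: "right_eigenvalue X q" and u: "u \<noteq> 0"
  shows "right_eigenvalue X (inverse u * q * u)"
proof -
  obtain v where v: "v \<in> carrier_vec n" "v \<noteq> 0\<^sub>v n" "X *\<^sub>v v = map_vec (\<lambda>x. x * q) v"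
    using q X unfolding right_eigenvalue_def by auto
  let ?w = "map_vec (\<lambda>x. x * u) v"
  have "?w \<noteq> 0\<^sub>v n"
  proof
    assume eq: "?w = 0\<^sub>v n"
    have "v = 0\<^sub>v n"
    proof (rule eq_vecI)
      fix i assume i: "i < dim_vec (0\<^sub>v n :: quat vec)"
      then have "v $ i * u = 0" using arg_cong[OF eq, of "\<lambda>w. w $ i"] v(1) by simp
      then show "v $ i = 0\<^sub>v n $ i" using u i by simp
    qed (use v in simp)
    then show False using v(2) by simp
  qed
  moreover have "X *\<^sub>v ?w = map_vec (\<lambda>x. x * (inverse u * q * u)) ?w"
  proof (rule eq_vecI)
    fix i assume "i < dim_vec (map_vec (\<lambda>x. x * (inverse u * q * u)) ?w)"
    then have i: "i < n" using v(1) by simp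
    have "(X *\<^sub>v ?w) $ i = (X *\<^sub>v v) $ i * u"
      using i X v(1) by (simp add: scalar_prod_def sum_distrib_right mult.assoc)
    also have "\<dots> = v $ i * q * u" using v(1) i unfolding v(3) by simp
    also have "\<dots> = v $ i * (u * inverse u) * q * u" using u by simp
    finally show "(X *\<^sub>v ?w) $ i = map_vec (\<lambda>x. x * (inverse u * q * u)) ?w $ i"
      using i v(1) by (simp add: mult.assoc)
  qed (use X v(1) in simp)
  ultimately show ?thesis
    unfolding right_eigenvalue_def using X v(1) by (intro bexI[of _ ?w]) auto
qed

lemma rep_class_eigenvalue_iff:
  assumes X: "X \<in> carrier_mat n n"
  shows "rep_class z \<in> eigenvalue_classes X \<longleftrightarrow> eigenvalue (quat_Phi X) z"
  unfolding right_eigenvalue_iff_Phi_eigenvalue[OF X, symmetric]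
proof
  assume "rep_class z \<in> eigenvalue_classes X"
  then obtain q where q: "rep_class z = quat_class q" "right_eigenvalue X q"
    unfolding eigenvalue_classes_def by blast
  have "quat_of_complex z \<in> quat_class q"
    unfolding q(1)[symmetric] quat_class_complex_iff by (rule disjI1[OF refl])
  then obtain u where u: "u \<noteq> 0" "quat_of_complex z = inverse u * q * u"
    unfolding quat_class_def by blast
  show "right_eigenvalue X (quat_of_complex z)"
    unfolding u(2) by (rule right_eigenvalue_class[OF X q(2) u(1)])
next
  assume "right_eigenvalue X (quat_of_complex z)"
  then show "rep_class z \<in> eigenvalue_classes X"
    unfolding eigenvalue_classes_def by (intro CollectI exI[of _ "quat_of_complex z"] conjI[OF refl])
qed

section \<open>The characterisation of real elements\<close>

text \<open>Both halves of the theorem end in this argument: \<open>p\<close> assigns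
  partitions, \<open>E\<close> says where they are non-empty, and \<open>N\<close>
  selects the numbers that the two conditions speak about, the others satisfying the
  symmetry for free. If \<open>z\<close> is no eigenvalue, the condition at
  \<open>- z\<close> applies, and if neither is, both partitions are empty.\<close>

lemma symmetric_iff_support_symmetric:
  fixes p :: "complex \<Rightarrow> nat multiset"
  assumes E: "\<And>z. E z \<longleftrightarrow> p z \<noteq> {#}"
    and N: "\<And>z. N z \<or> p z = p (- z)" "\<And>z. N (- z) \<longleftrightarrow> N z"
  shows "(\<forall>z. p z = p (- z)) \<longleftrightarrow>
    (\<forall>z. E z \<and> N z \<longrightarrow> E (- z) \<and> sum_mset (p (- z)) = sum_mset (p z)) \<and>
    (\<forall>z. E z \<and> N z \<longrightarrow> p z = p (- z))"
proof
  assume R: "(\<forall>z. E z \<and> N z \<longrightarrow> E (- z) \<and> sum_mset (p (- z)) = sum_mset (p z)) \<and>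
    (\<forall>z. E z \<and> N z \<longrightarrow> p z = p (- z))"
  show "\<forall>z. p z = p (- z)"
  proof
    fix z
    show "p z = p (- z)"
    proof (cases "N z")
      case True
      then consider "E z" | "E (- z)" | "p z = {#}" "p (- z) = {#}" using E by blast
      then show ?thesis
      proof cases
        case 2
        then have "p (- z) = p (- (- z))" using R True N(2) by blast
        then show ?thesis by simp
      qed (use R True in simp_all)
    qed (use N(1) in blast)
  qed
next
  assume L: "\<forall>z. p z = p (- z)"
  have "p (- z) = p z" for z by (rule L[rule_format, symmetric])
  then show "(\<forall>z. E z \<and> N z \<longrightarrow> E (- z) \<and> sum_mset (p (- z)) = sum_mset (p z)) \<and>
    (\<forall>z. E z \<and> N z \<longrightarrow> p z = p (- z))"
    by (simp add: E)
qed

theorem theorem1p1: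
  fixes n :: nat
  shows
    "(\<forall>X \<in> sl_complex n.
        Ad_real n (SL_complex n) X \<longleftrightarrow>
          (\<forall>z. eigenvalue X z \<and> z \<noteq> 0 \<longrightarrow>
             eigenvalue X (- z) \<and> multiplicity_complex X (- z) = multiplicity_complex X z) \<and>
          (\<forall>z. eigenvalue X z \<and> z \<noteq> 0 \<longrightarrow>
             partition_complex X z = partition_complex X (- z)))
     \<and>
     (\<forall>X \<in> sl_quat n.
        Ad_real n (SL_quat n) X \<longleftrightarrow>
          (\<forall>z. rep_class z \<in> eigenvalue_classes X \<and> Re z \<noteq> 0 \<longrightarrow>
             rep_class (- z) \<in> eigenvalue_classes X \<and>
             multiplicity_quat X (rep_class (- z)) = multiplicity_quat X (rep_class z)) \<and>
          (\<forall>z. rep_class z \<in> eigenvalue_classes X \<and> Re z \<noteq> 0 \<longrightarrow>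
             partition_quat X (rep_class z) = partition_quat X (rep_class (- z))))"
proof (intro conjI ballI)
  fix X assume "X \<in> sl_complex n"
  then have X: "X \<in> carrier_mat n n" unfolding sl_complex_def by blast
  obtain xs where xs: "jordan_nf X xs" using complex_jordan_nf_exists[OF X] .
  have ev: "eigenvalue X z \<longleftrightarrow> block_sizes xs z \<noteq> {#}" for z
    by (rule eigenvalue_iff_block_sizes[OF xs X])
  have zero: "z \<noteq> 0 \<or> block_sizes xs z = block_sizes xs (- z)" for z by simp
  have neg_nonzero: "- z \<noteq> 0 \<longleftrightarrow> z \<noteq> 0" for z :: complex by simp
  show "Ad_real n (SL_complex n) X \<longleftrightarrow>
      (\<forall>z. eigenvalue X z \<and> z \<noteq> 0 \<longrightarrow>
         eigenvalue X (- z) \<and> multiplicity_complex X (- z) = multiplicity_complex X z) \<and>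
      (\<forall>z. eigenvalue X z \<and> z \<noteq> 0 \<longrightarrow> partition_complex X z = partition_complex X (- z))"
    unfolding Ad_real_SL_complex_iff[OF X] similar_uminus_iff_block_sizes[OF xs]
      multiplicity_complex_def partition_complex_eq[OF xs]
    using symmetric_iff_support_symmetric[of "eigenvalue X" "block_sizes xs" "\<lambda>z. z \<noteq> 0",
      OF ev zero neg_nonzero] .
next
  fix X assume "X \<in> sl_quat n"
  then have X: "X \<in> carrier_mat n n" unfolding sl_quat_def by blast
  obtain xs where xs: "quat_jordan_nf X xs" using quat_jordan_nf_exists[OF X] .
  let ?p = "\<lambda>z. block_sizes xs (upper_rep z)" and ?q = "block_sizes (xs @ conj_blocks xs)"
  have Phi: "jordan_nf (quat_Phi X) (xs @ conj_blocks xs)" and im: "\<forall>b\<in>set xs. 0 \<le> Im (snd b)"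
    using xs unfolding quat_jordan_nf_iff[OF X] by blast+
  have PX: "quat_Phi X \<in> carrier_mat (n + n) (n + n)" using X by simp
  have q: "?q z = (if Im z = 0 then ?p z + ?p z else ?p z)" for z
    by (simp add: block_sizes_append_conj[OF im])
  have eq_iff: "?q z = ?q (- z) \<longleftrightarrow> ?p z = ?p (- z)" for z
  proof (cases "Im z = 0")
    case True
    then have "Im (- z) = 0" by simp
    then show ?thesis
      using q[of z] q[of "- z"] unfolding if_P[OF True] if_P[OF \<open>Im (- z) = 0\<close>]
      by (simp only: multiset_add_self_eq_iff)
  next
    case False
    then have "Im (- z) \<noteq> 0" by simp
    then show ?thesis
      using q[of z] q[of "- z"] unfolding if_not_P[OF False] if_not_P[OF \<open>Im (- z) \<noteq> 0\<close>]
      by (simp only:)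
  qed
  have "similar_mat (- X) X \<longleftrightarrow> similar_mat (- quat_Phi X) (quat_Phi X)"
    using quat_similar_iff_Phi_similar[of "- X" n X] X by simp
  also have "\<dots> \<longleftrightarrow> (\<forall>z. ?p z = ?p (- z))"
    unfolding similar_uminus_iff_block_sizes[OF Phi] eq_iff ..
  finally have real: "Ad_real n (SL_quat n) X \<longleftrightarrow> (\<forall>z. ?p z = ?p (- z))"
    unfolding Ad_real_SL_quat_iff[OF X] .
  have ev: "rep_class z \<in> eigenvalue_classes X \<longleftrightarrow> ?p z \<noteq> {#}" for z
    unfolding rep_class_eigenvalue_iff[OF X] eigenvalue_iff_block_sizes[OF Phi PX] q by auto
  have imaginary: "Re z \<noteq> 0 \<or> ?p z = ?p (- z)" for z
  proof (cases "Re z = 0")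
    case True
    then have "upper_rep z = upper_rep (- z)" by (simp add: complex_eq_iff)
    then have "?p z = ?p (- z)" by (rule arg_cong)
    then show ?thesis ..
  qed simp
  have Re_minus_nonzero: "Re (- z) \<noteq> 0 \<longleftrightarrow> Re z \<noteq> 0" for z by simp
  show "Ad_real n (SL_quat n) X \<longleftrightarrow>
      (\<forall>z. rep_class z \<in> eigenvalue_classes X \<and> Re z \<noteq> 0 \<longrightarrow>
         rep_class (- z) \<in> eigenvalue_classes X \<and>
         multiplicity_quat X (rep_class (- z)) = multiplicity_quat X (rep_class z)) \<and>
      (\<forall>z. rep_class z \<in> eigenvalue_classes X \<and> Re z \<noteq> 0 \<longrightarrow>
         partition_quat X (rep_class z) = partition_quat X (rep_class (- z)))"
    unfolding real multiplicity_quat_def partition_quat_eq[OF X xs]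
    using symmetric_iff_support_symmetric[of "\<lambda>z. rep_class z \<in> eigenvalue_classes X" ?p
      "\<lambda>z. Re z \<noteq> 0", OF ev imaginary Re_minus_nonzero] .
qed

end
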